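(* Let $f=(f_1,\ldots,f_m)\colon\mathbb{R}^n\to\mathbb{R}^m$ be a locally Lipschitz mapping and let $\Omega\subset\mathbb{R}^n$ be a nonempty closed set. Assume that $$[f(\Omega)]^{\oplus}\cap(-\mathbb{R}^m_+)=\{0\},$$ where $[\cdot]^{\oplus}$ denotes the recession cone. Then the following conditions are equivalent, and each of them is sufficient for the existence of a Geoffrion-properly efficient solution to the problem $\mathrm{Min}_{\mathbb{R}^m_+}\{f(x)\mid x\in\Omega\}$: (i) $f|_{\Omega}$ is proper; (ii) $f|_{\Omega}$ satisfies the Palais--Smale condition, i.e., $\widetilde K_{\infty}(f,\Omega)=\emptyset$; (iii) $f|_{\Omega}$ satisfies the weak Palais--Smale condition, i.e., $K_{\infty}(f,\Omega)=\emptyset$; (iv) $f|_{\Omega}$ is $M$-tame, i.e., $T_{\infty}(f,\Omega)=\emptyset$.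
   Context: $\mathbb{R}^n$ carries the usual scalar product $\langle\cdot,\cdot\rangle$ and Euclidean norm $\|\cdot\|$. $\mathbb{R}^m_+$ is the set of vectors in $\mathbb{R}^m$ with all components $\ge 0$. For $a,b\in\mathbb{R}^m$, $a\leqq b$ means $b-a\in\mathbb{R}^m_+$. Efficiency: $\bar x\in\Omega$ is a Pareto efficient solution to $\mathrm{Min}_{\mathbb{R}^m_+}\{f(x)\mid x\in\Omega\}$ if there is no $x\in\Omega$ with $f(x)\leqq f(\bar x)$ and $f(x)\ne f(\bar x)$. It is a Geoffrion-properly efficient solution if it is Pareto efficient and there is a real number $M>0$ such that whenever $i\in\{1,\ldots,m\}$ and $x\in\Omega$ satisfy $f_i(x)<f_i(\bar x)$, there exists $j\in\{1,\ldots,m\}$ with $f_j(\bar x)<f_j(x)$ and $\dfrac{f_i(\bar x)-f_i(x)}{f_j(x)-f_j(\bar x)}\le M$. Recession cone: for $Y\subset\mathbb{R}^m$, $[Y]^{\oplus}:=\{d\in\mathbb{R}^m\mid \exists\,\{(t_k,y^k)\}\subset\mathbb{R}_+\times Y \text{ such that } t_k\to 0 \text{ and } t_k y^k\to d\}$. Properness: $f|_\Omega$ is proper at sublevel $y\in\mathbb{R}^m$ if for every sequence $\{x^k\}\subset\Omega$ with $\|x^k\|\to\infty$ and $f(x^k)\leqq y$ for all $k$, one has $\|f(x^k)\|\to\infty$ as $k\to\infty$. $f|_\Omega$ is proper if it is proper at every sublevel $y\in\mathbb{R}^m$. Normal cones and subdifferential: for $\Omega\subset\mathbb{R}^n$ and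 $\bar x\in\Omega$, the regular normal cone $\widehat N(\bar x;\Omega)$ consists of all $v\in\mathbb{R}^n$ with $\langle v,x-\bar x\rangle\le o(\|x-\bar x\|)$ as $x\to\bar x$, $x\in\Omega$. The limiting normal cone $N(\bar x;\Omega)$ consists of all $v$ for which there are sequences $x^k\to\bar x$ with $x^k\in\Omega$ and $v^k\to v$ with $v^k\in\widehat N(x^k;\Omega)$. For $\phi\colon\mathbb{R}^n\to\mathbb{R}$, the limiting subdifferential is $\partial\phi(\bar x):=\{v\in\mathbb{R}^n \mid (v,-1)\in N((\bar x,\phi(\bar x));\mathrm{epi}\,\phi)\}$, where $\mathrm{epi}\,\phi=\{(x,y)\in\mathbb{R}^n\times\mathbb{R}\mid \phi(x)\le y\}$. Rabier function: $$\nu(x):=\inf\Big\{\Big\|\sum_{i=1}^m\lambda_i v^i+w\Big\| \;\Big|\; v^i\in\partial f_i(x)\cup\partial(-f_i)(x),\ w\in N(x;\Omega),\ \lambda\in\mathbb{R}^m_+,\ \sum_{i=1}^m\lambda_i=1\Big\}.$$ The set $\Gamma(f,\Omega)$ consists of all $x\in\Omega$ for which there exist $v^i\in\partial f_i(x)\cup\partial(-f_i)(x)$, $i=1,\ldots,m$, and $(\lambda,\mu)\in\mathbb{R}^m_+\times\mathbb{R}$ with $\sum_{i=1}^m\lambda_i+|\mu|=1$ such that $0\in\sum_{i=1}^m\lambda_i v^i+\mu x+N(x;\Omega)$. Sets at infinity (no sublevel restriction): - $\widetilde K_{\infty}(f,\Omega)$ is the set of $y\in\mathbb{R}^m$ for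 which there is a sequence $\{x^k\}\subset\Omega$ with $\|x^k\|\to\infty$, $f(x^k)\to y$, and $\nu(x^k)\to 0$. - $K_{\infty}(f,\Omega)$ is the set of $y\in\mathbb{R}^m$ for which there is a sequence $\{x^k\}\subset\Omega$ with $\|x^k\|\to\infty$, $f(x^k)\to y$, and $\|x^k\|\nu(x^k)\to 0$. - $T_{\infty}(f,\Omega)$ is the set of $y\in\mathbb{R}^m$ for which there is a sequence $\{x^k\}\subset\Gamma(f,\Omega)$ with $\|x^k\|\to\infty$ and $f(x^k)\to y$. *)

theory Defs
  imports "HOL-Analysis.Analysis"
begin

definition locally_lipschitz :: "('a::metric_space \<Rightarrow> 'b::metric_space) \<Rightarrow> bool" where
  "locally_lipschitz f \<longleftrightarrow> (\<forall>x. \<exists>r>0. \<exists>L. L-lipschitz_on (ball x r) f)"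

text \<open>The order on \<^typ>\<open>real^'m\<close> is the library's componentwise order.\<close>

definition nonneg_orthant :: "(real^'m) set" where
  "nonneg_orthant = {y. \<forall>i. 0 \<le> y $ i}"

lemma le_iff_diff_nonneg_orthant:
  fixes a b :: "real^'m"
  shows "a \<le> b \<longleftrightarrow> b - a \<in> nonneg_orthant"
  by (simp add: nonneg_orthant_def less_eq_vec_def)

definition pareto_efficient :: "('a \<Rightarrow> real^'m) \<Rightarrow> 'a set \<Rightarrow> 'a \<Rightarrow> bool" where
  "pareto_efficient f \<Omega> xb \<longleftrightarrow>
     xb \<in> \<Omega> \<and> \<not> (\<exists>x\<in>\<Omega>. f x \<le> f xb \<and> f x \<noteq> f xb)"

definition geoffrion_properly_efficient :: "('a \<Rightarrow> real^'m) \<Rightarrow> 'a set \<Rightarrow> 'a \<Rightarrow> bool" where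
  "geoffrion_properly_efficient f \<Omega> xb \<longleftrightarrow>
     pareto_efficient f \<Omega> xb \<and>
     (\<exists>M::real. M > 0 \<and>
        (\<forall>i. \<forall>x\<in>\<Omega>. f x $ i < f xb $ i \<longrightarrow>
           (\<exists>j. f xb $ j < f x $ j \<and>
                (f xb $ i - f x $ i) / (f x $ j - f xb $ j) \<le> M)))"

definition recession_cone :: "'a::real_normed_vector set \<Rightarrow> 'a set" where
  "recession_cone Y =
     {d. \<exists>(t :: nat \<Rightarrow> real) (y :: nat \<Rightarrow> 'a).
           (\<forall>k. 0 \<le> t k \<and> y k \<in> Y) \<and>
           t \<longlonglongrightarrow> 0 \<and> (\<lambda>k. t k *\<^sub>R y k) \<longlonglongrightarrow> d}"

definition proper_at_sublevel ::
  "('a::real_normed_vector \<Rightarrow> real^'m) \<Rightarrow> 'a set \<Rightarrow> real^'m \<Rightarrow> bool" where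
  "proper_at_sublevel f \<Omega> y \<longleftrightarrow>
     (\<forall>x :: nat \<Rightarrow> 'a.
        (\<forall>k. x k \<in> \<Omega>) \<and> filterlim (\<lambda>k. norm (x k)) at_top sequentially \<and>
        (\<forall>k. f (x k) \<le> y) \<longrightarrow>
        filterlim (\<lambda>k. norm (f (x k))) at_top sequentially)"

definition proper_on :: "('a::real_normed_vector \<Rightarrow> real^'m) \<Rightarrow> 'a set \<Rightarrow> bool" where
  "proper_on f \<Omega> \<longleftrightarrow> (\<forall>y. proper_at_sublevel f \<Omega> y)"

text \<open>The condition \<open>\<langle>v, x - xb\<rangle> \<le> o(\<parallel>x - xb\<parallel>)\<close> is one-sided: the positive part of the
  left-hand side is \<open>o(\<parallel>x - xb\<parallel>)\<close> as \<open>x \<rightarrow> xb\<close> in \<open>\<Omega>\<close>.\<close>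

definition regular_normal_cone :: "'a::real_inner \<Rightarrow> 'a set \<Rightarrow> 'a set" where
  "regular_normal_cone xb \<Omega> =
     {v. \<forall>\<epsilon>>0. \<forall>\<^sub>F x in at xb within \<Omega>. v \<bullet> (x - xb) \<le> \<epsilon> * norm (x - xb)}"

definition limiting_normal_cone :: "'a::real_inner \<Rightarrow> 'a set \<Rightarrow> 'a set" where
  "limiting_normal_cone xb \<Omega> =
     {v. \<exists>(x :: nat \<Rightarrow> 'a) (u :: nat \<Rightarrow> 'a).
           (\<forall>k. x k \<in> \<Omega> \<and> u k \<in> regular_normal_cone (x k) \<Omega>) \<and>
           x \<longlonglongrightarrow> xb \<and> u \<longlonglongrightarrow> v}"

text \<open>The library's \<^const>\<open>epigraph\<close> with base set \<^const>\<open>UNIV\<close> is the full epigraph in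
  the product space, whose inner product is the Euclidean one.\<close>

definition limiting_subdifferential :: "('a::real_inner \<Rightarrow> real) \<Rightarrow> 'a \<Rightarrow> 'a set" where
  "limiting_subdifferential \<phi> xb =
     {v. (v, -1) \<in> limiting_normal_cone (xb, \<phi> xb) (epigraph UNIV \<phi>)}"

definition component_subgradients ::
  "('a::real_inner \<Rightarrow> real^'m) \<Rightarrow> 'a \<Rightarrow> 'm \<Rightarrow> 'a set" where
  "component_subgradients f x i =
     limiting_subdifferential (\<lambda>z. f z $ i) x \<union> limiting_subdifferential (\<lambda>z. - (f z $ i)) x"

text \<open>The infimum is taken in the extended reals, so that \<open>inf {} = \<infinity>\<close>.\<close>

definition rabier :: "('a::real_inner \<Rightarrow> real^'m) \<Rightarrow> 'a set \<Rightarrow> 'a \<Rightarrow> ereal" where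
  "rabier f \<Omega> x =
     Inf {ereal (norm ((\<Sum>i\<in>UNIV. lam $ i *\<^sub>R v i) + w)) | (lam :: real^'m) v w.
            (\<forall>i. v i \<in> component_subgradients f x i) \<and>
            w \<in> limiting_normal_cone x \<Omega> \<and>
            lam \<in> nonneg_orthant \<and> (\<Sum>i\<in>UNIV. lam $ i) = 1}"

definition Gamma_set :: "('a::real_inner \<Rightarrow> real^'m) \<Rightarrow> 'a set \<Rightarrow> 'a set" where
  "Gamma_set f \<Omega> =
     {x \<in> \<Omega>. \<exists>v (lam :: real^'m) (\<mu> :: real).
        (\<forall>i. v i \<in> component_subgradients f x i) \<and>
        lam \<in> nonneg_orthant \<and> (\<Sum>i\<in>UNIV. lam $ i) + \<bar>\<mu>\<bar> = 1 \<and>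
        (\<exists>w \<in> limiting_normal_cone x \<Omega>. 0 = (\<Sum>i\<in>UNIV. lam $ i *\<^sub>R v i) + \<mu> *\<^sub>R x + w)}"

definition K_tilde_inf :: "('a::real_inner \<Rightarrow> real^'m) \<Rightarrow> 'a set \<Rightarrow> (real^'m) set" where
  "K_tilde_inf f \<Omega> =
     {y. \<exists>x :: nat \<Rightarrow> 'a. (\<forall>k. x k \<in> \<Omega>) \<and>
           filterlim (\<lambda>k. norm (x k)) at_top sequentially \<and>
           (\<lambda>k. f (x k)) \<longlonglongrightarrow> y \<and> (\<lambda>k. rabier f \<Omega> (x k)) \<longlonglongrightarrow> 0}"

definition K_inf :: "('a::real_inner \<Rightarrow> real^'m) \<Rightarrow> 'a set \<Rightarrow> (real^'m) set" where
  "K_inf f \<Omega> =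
     {y. \<exists>x :: nat \<Rightarrow> 'a. (\<forall>k. x k \<in> \<Omega>) \<and>
           filterlim (\<lambda>k. norm (x k)) at_top sequentially \<and>
           (\<lambda>k. f (x k)) \<longlonglongrightarrow> y \<and> (\<lambda>k. ereal (norm (x k)) * rabier f \<Omega> (x k)) \<longlonglongrightarrow> 0}"

definition T_inf :: "('a::real_inner \<Rightarrow> real^'m) \<Rightarrow> 'a set \<Rightarrow> (real^'m) set" where
  "T_inf f \<Omega> =
     {y. \<exists>x :: nat \<Rightarrow> 'a. (\<forall>k. x k \<in> Gamma_set f \<Omega>) \<and>
           filterlim (\<lambda>k. norm (x k)) at_top sequentially \<and>
           (\<lambda>k. f (x k)) \<longlonglongrightarrow> y}"

definition palais_smale :: "('a::real_inner \<Rightarrow> real^'m) \<Rightarrow> 'a set \<Rightarrow> bool" where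
  "palais_smale f \<Omega> \<longleftrightarrow> K_tilde_inf f \<Omega> = {}"

definition weak_palais_smale :: "('a::real_inner \<Rightarrow> real^'m) \<Rightarrow> 'a set \<Rightarrow> bool" where
  "weak_palais_smale f \<Omega> \<longleftrightarrow> K_inf f \<Omega> = {}"

definition M_tame :: "('a::real_inner \<Rightarrow> real^'m) \<Rightarrow> 'a set \<Rightarrow> bool" where
  "M_tame f \<Omega> \<longleftrightarrow> T_inf f \<Omega> = {}"

end

theory Submission
  imports Defs
begin

text \<open>Everything is read off from the scalar function \<open>\<phi> x = (\<Sum>i. exp (f\<^sub>i x))\<close>. The recession condition bounds
  \<open>f\<close> on the sublevel sets of \<open>\<phi>\<close> in \<open>\<Omega>\<close>, so properness means that these sublevel sets are bounded,
  and then no point of any of the sets at infinity can exist. If some sublevel set is unbounded, a minimizer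
  of \<open>\<phi> u + (\<parallel>u\<parallel>\<^sup>2 - \<parallel>x\<parallel>\<^sup>2)\<^sup>2\<close> with \<open>x\<close> far away lies in \<open>\<Gamma>\<close>, and a minimizer of
  \<open>\<phi> u + c \<parallel>u - x\<parallel>\<^sup>2\<close> outside a ball, with \<open>\<phi> x\<close> close to the lower limit of \<open>\<phi>\<close> at infinity and
  a suitable small \<open>c\<close>, has small \<open>\<parallel>u\<parallel> \<nu> u\<close>. Stationarity of such minimizers comes from decoupling: each \<open>f\<^sub>i\<close>
  gets its own variable, tied to the point of \<open>\<Omega>\<close> by a quadratic penalty. The exponential makes all weights
  positive, so that every \<open>f\<^sub>i\<close> receives a subgradient. Finally, a minimizer of \<open>\<phi>\<close> on \<open>\<Omega>\<close> is properly
  efficient.\<close>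

section \<open>Normal cones and smooth minorants\<close>

lemma regular_normal_cone_scaleR:
  assumes "v \<in> regular_normal_cone x S" and "c > 0"
  shows "c *\<^sub>R v \<in> regular_normal_cone x S"
  unfolding regular_normal_cone_def
proof (intro CollectI allI impI)
  fix e :: real assume "e > 0"
  then have "e / c > 0" using assms by simp
  then have "\<forall>\<^sub>F y in at x within S. v \<bullet> (y - x) \<le> (e / c) * norm (y - x)"
    using assms(1) unfolding regular_normal_cone_def by blast
  then show "\<forall>\<^sub>F y in at x within S. (c *\<^sub>R v) \<bullet> (y - x) \<le> e * norm (y - x)"
  proof eventually_elim
    case (elim y)
    then have "c * (v \<bullet> (y - x)) \<le> c * ((e / c) * norm (y - x))"
      using assms by (intro mult_left_mono) auto
    then show ?case using assms by simp
  qed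
qed

text \<open>Lets a stationarity relation be rescaled so that its multipliers sum to one.\<close>

lemma limiting_normal_cone_scaleR:
  assumes "v \<in> limiting_normal_cone x S" and "c > 0"
  shows "c *\<^sub>R v \<in> limiting_normal_cone x S"
proof -
  obtain y u where yu: "\<And>k. y k \<in> S" "\<And>k. u k \<in> regular_normal_cone (y k) S"
    "y \<longlonglongrightarrow> x" "u \<longlonglongrightarrow> v"
    using assms(1) unfolding limiting_normal_cone_def by blast
  have "(\<lambda>k. c *\<^sub>R u k) \<longlonglongrightarrow> c *\<^sub>R v" using yu by (intro tendsto_intros)
  moreover have "\<And>k. c *\<^sub>R u k \<in> regular_normal_cone (y k) S"
    using yu assms by (intro regular_normal_cone_scaleR)
  ultimately show ?thesis using yu unfolding limiting_normal_cone_def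
    by (intro CollectI exI[of _ y] exI[of _ "\<lambda>k. c *\<^sub>R u k"]) auto
qed

text \<open>Fermat's rule relative to a set: near a local minimum the increment of \<open>h\<close>
  is nonnegative, so \<open>(- G) \<bullet> (x - z)\<close> is at most the first-order remainder of
  \<open>h\<close>.\<close>

lemma regular_normal_of_local_min:
  assumes der: "(h has_derivative (\<lambda>d. G \<bullet> d)) (at z)"
    and min: "\<forall>\<^sub>F x in at z within S. h z \<le> h x"
  shows "- G \<in> regular_normal_cone z S"
  unfolding regular_normal_cone_def
proof (intro CollectI allI impI)
  fix e :: real assume "e > 0"
  then obtain d where d: "d > 0"
    "\<And>y. norm (y - z) < d \<Longrightarrow> norm (h y - h z - G \<bullet> (y - z)) \<le> e * norm (y - z)"
    using der unfolding has_derivative_at_alt by blast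
  have "\<forall>\<^sub>F x in at z within S. dist x z < d"
    using d(1) by (metis eventually_at)
  with min show "\<forall>\<^sub>F x in at z within S. (- G) \<bullet> (x - z) \<le> e * norm (x - z)"
  proof eventually_elim
    case (elim x)
    then have "norm (h x - h z - G \<bullet> (x - z)) \<le> e * norm (x - z)"
      using d(2) by (simp add: dist_norm)
    then show ?case using elim by (simp add: abs_le_iff)
  qed
qed

text \<open>The function \<open>snd p - l (fst p)\<close> vanishes at the touching point and is
  nonnegative on the epigraph nearby, so Fermat's rule applies with gradient
  \<open>(- v, 1)\<close>.\<close>

lemma regular_normal_epigraph_of_minorant:
  fixes \<phi> l :: "'a::real_inner \<Rightarrow> real"
  assumes der: "(l has_derivative (\<lambda>d. v \<bullet> d)) (at x)"
    and touch: "l x = \<phi> x" and below: "\<forall>\<^sub>F u in nhds x. l u \<le> \<phi> u"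
  shows "(v, -1) \<in> regular_normal_cone (x, \<phi> x) (epigraph UNIV \<phi>)"
proof -
  have "((\<lambda>p. snd p - l (fst p)) has_derivative (\<lambda>d. snd d - v \<bullet> fst d)) (at (x, \<phi> x))"
    using has_derivative_compose[OF has_derivative_fst[OF has_derivative_ident],
      where g = l and g' = "\<lambda>d. v \<bullet> d" and x = "(x, \<phi> x)" and s = UNIV] der
    by (intro has_derivative_diff has_derivative_snd has_derivative_ident) auto
  then have "((\<lambda>p. snd p - l (fst p)) has_derivative (\<lambda>d. (- v, 1) \<bullet> d)) (at (x, \<phi> x))"
    by (simp add: inner_prod_def)
  moreover have "\<forall>\<^sub>F p in at (x, \<phi> x) within epigraph UNIV \<phi>.
      snd (x, \<phi> x) - l (fst (x, \<phi> x)) \<le> snd p - l (fst p)"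
  proof -
    have "(fst \<longlongrightarrow> fst (x, \<phi> x)) (at (x, \<phi> x) within epigraph UNIV \<phi>)"
      by (intro tendsto_fst tendsto_ident_at)
    then have "(fst \<longlongrightarrow> x) (at (x, \<phi> x) within epigraph UNIV \<phi>)"
      by simp
    then have "\<forall>\<^sub>F p in at (x, \<phi> x) within epigraph UNIV \<phi>. l (fst p) \<le> \<phi> (fst p)"
      by (rule eventually_compose_filterlim[OF below])
    moreover have "\<forall>\<^sub>F p in at (x, \<phi> x) within epigraph UNIV \<phi>. p \<in> epigraph UNIV \<phi>"
      by (auto simp: eventually_at_filter)
    ultimately show ?thesis
      by eventually_elim (auto simp: touch mem_epigraph)
  qed
  ultimately have "- (- v, 1) \<in> regular_normal_cone (x, \<phi> x) (epigraph UNIV \<phi>)"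
    by (rule regular_normal_of_local_min)
  then show ?thesis by simp
qed

text \<open>Solving \<open>exp (\<phi> u) + q u \<ge> exp (\<phi> x) + q x\<close> for \<open>\<phi> u\<close> yields a smooth minorant of \<open>\<phi>\<close>.\<close>

lemma regular_normal_epigraph_of_exp_min:
  fixes \<phi> q :: "'a::real_inner \<Rightarrow> real"
  assumes der: "(q has_derivative (\<lambda>d. Q \<bullet> d)) (at x)"
    and min: "\<forall>\<^sub>F u in nhds x. exp (\<phi> x) + q x \<le> exp (\<phi> u) + q u"
  shows "(- (1 / exp (\<phi> x)) *\<^sub>R Q, -1) \<in> regular_normal_cone (x, \<phi> x) (epigraph UNIV \<phi>)"
proof (rule regular_normal_epigraph_of_minorant)
  let ?l = "\<lambda>u. ln (exp (\<phi> x) + q x - q u)"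
  show "(?l has_derivative (\<lambda>d. (- (1 / exp (\<phi> x)) *\<^sub>R Q) \<bullet> d)) (at x)"
    by (auto intro!: derivative_eq_intros der simp: field_simps)
  show "?l x = \<phi> x" by simp
  have "isCont q x" using der has_derivative_continuous by blast
  then have "(q \<longlongrightarrow> q x) (nhds x)" by (simp add: continuous_at filterlim_at tendsto_at_iff_tendsto_nhds)
  then have "((\<lambda>u. exp (\<phi> x) + q x - q u) \<longlongrightarrow> exp (\<phi> x) + q x - q x) (nhds x)"
    by (intro tendsto_intros)
  \<comment> \<open>The argument of \<open>ln\<close> equals \<open>exp (\<phi> x)\<close> at
    \<open>x\<close> and stays positive nearby, as monotonicity of \<open>ln\<close>
    requires.\<close>
  then have "\<forall>\<^sub>F u in nhds x. 0 < exp (\<phi> x) + q x - q u"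
    by (rule order_tendstoD) simp
  with min show "\<forall>\<^sub>F u in nhds x. ?l u \<le> \<phi> u"
  proof eventually_elim
    case (elim u)
    then have "?l u \<le> ln (exp (\<phi> u))" by (subst ln_le_cancel_iff) auto
    then show ?case by simp
  qed
qed

section \<open>Stationarity of minimizers of a sum of exponentials\<close>

lemma locally_lipschitz_imp_continuous_on:
  assumes "locally_lipschitz f" shows "continuous_on A f"
proof -
  have "isCont f x" for x
  proof -
    obtain r L where "r > 0" "L-lipschitz_on (ball x r) f"
      using assms unfolding locally_lipschitz_def by blast
    then have "continuous_on (ball x r) f" by (simp add: lipschitz_on_continuous_on)
    with \<open>r > 0\<close> show ?thesis by (simp add: continuous_on_eq_continuous_at)
  qed
  then show ?thesis by (simp add: continuous_at_imp_continuous_on)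
qed

text \<open>Convexity: the tangent of \<open>exp\<close> at \<open>a\<close>, evaluated at
  \<open>b\<close>, lies below the graph.\<close>

lemma exp_diff_le: "exp a - exp b \<le> exp a * (a - b)" for a b :: real
proof -
  have "exp a * (1 + (b - a)) \<le> exp a * exp (b - a)"
    by (intro mult_left_mono exp_ge_add_one_self) auto
  then show ?thesis by (simp add: algebra_simps flip: exp_add)
qed

text \<open>On a ball where \<open>f\<close> is Lipschitz its components are bounded, and on a
  bounded range \<open>exp\<close> is Lipschitz. The lower bound \<open>b\<close> later controls
  subgradients, which carry a factor \<open>1 / exp (f x $ i)\<close>.\<close>

lemma exp_component_local_bounds:
  fixes f :: "'a::real_normed_vector \<Rightarrow> real^'m"
  assumes "locally_lipschitz f"
  obtains r L b where "r > 0" "L > 0" "b > 0"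
    "\<And>x y i. x \<in> cball z r \<Longrightarrow> y \<in> cball z r \<Longrightarrow>
       exp (f x $ i) - exp (f y $ i) \<le> L * norm (x - y)"
    "\<And>x i. x \<in> cball z r \<Longrightarrow> b \<le> exp (f x $ i)"
proof -
  obtain r0 L0 where r0: "r0 > 0" and L0: "L0-lipschitz_on (ball z r0) f"
    using assms unfolding locally_lipschitz_def by blast
  \<comment> \<open>Halving fits the closed ball into the open ball of Lipschitz continuity.\<close>
  define r where "r = r0 / 2"
  have sub: "cball z r \<subseteq> ball z r0" using r0 by (auto simp: r_def)
  have L0': "L0 \<ge> 0" using L0 lipschitz_on_nonneg by blast
  have lip: "\<bar>f x $ i - f y $ i\<bar> \<le> L0 * norm (x - y)"
    if "x \<in> cball z r" "y \<in> cball z r" for x y i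
  proof -
    have "\<bar>f x $ i - f y $ i\<bar> \<le> norm (f x - f y)"
      using component_le_norm_cart[of "f x - f y" i] by simp
    also have "\<dots> \<le> L0 * norm (x - y)"
      using lipschitz_onD[OF L0, of x y] that sub by (metis dist_norm subsetD)
    finally show ?thesis .
  qed
  define B where "B = norm (f z) + L0 * r"
  have bd: "\<bar>f x $ i\<bar> \<le> B" if "x \<in> cball z r" for x i
  proof -
    have "\<bar>f x $ i - f z $ i\<bar> \<le> L0 * norm (x - z)"
      using lip[of x z i] that r0 by (auto simp: r_def)
    also have "\<dots> \<le> L0 * r" using that L0' by (intro mult_left_mono) (auto simp: dist_norm norm_minus_commute)
    finally show ?thesis using component_le_norm_cart[of "f z" i] unfolding B_def by linarith
  qed
  show ?thesis
  \<comment> \<open>The summand 1 keeps the constant positive even when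
    \<open>L0 = 0\<close>.\<close>
  proof (rule that[of r "exp B * L0 + 1" "exp (- B)"])
    show "r > 0" using r0 by (simp add: r_def)
    show "exp B * L0 + 1 > 0" using L0' by (simp add: add_nonneg_pos)
    show "exp (- B) > 0" by simp
    show "exp (- B) \<le> exp (f x $ i)" if "x \<in> cball z r" for x i
      using bd[OF that, of i] by simp
    show "exp (f x $ i) - exp (f y $ i) \<le> (exp B * L0 + 1) * norm (x - y)"
      if "x \<in> cball z r" "y \<in> cball z r" for x y i
    proof -
      have "exp (f x $ i) - exp (f y $ i) \<le> exp (f x $ i) * (f x $ i - f y $ i)"
        by (rule exp_diff_le)
      also have "\<dots> \<le> exp (f x $ i) * \<bar>f x $ i - f y $ i\<bar>" by (intro mult_left_mono) auto
      also have "\<dots> \<le> exp B * (L0 * norm (x - y))"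
        using bd[OF that(1), of i] lip[OF that] by (intro mult_mono) auto
      also have "\<dots> \<le> (exp B * L0 + 1) * norm (x - y)" by (simp add: algebra_simps)
      finally show ?thesis .
    qed
  qed
qed

text \<open>Decoupling: each component of \<open>f\<close> is evaluated at its own variable
  \<open>X $ i\<close>, tied to \<open>x\<close> by a penalty with factor \<open>k\<close>.
  Compactness yields a joint minimizer, the extra term \<open>(norm (x - z))\<^sup>2\<close> draws
  it to \<open>z\<close>, and the last two conclusions are minimality in one variable at a
  time.\<close>

lemma exp_sum_penalized_minimizer:
  fixes f :: "'a::euclidean_space \<Rightarrow> real^'m"
  assumes f: "locally_lipschitz f" and \<Omega>: "closed \<Omega>" "z \<in> \<Omega>"
    and g: "continuous_on UNIV g"
    and min: "\<And>x. x \<in> \<Omega> \<Longrightarrow> x \<in> cball z r \<Longrightarrow>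
       (\<Sum>i\<in>UNIV. exp (f z $ i)) + g z \<le> (\<Sum>i\<in>UNIV. exp (f x $ i)) + g x"
    and L: "L > 0"
       "\<And>x y i. x \<in> cball z r \<Longrightarrow> y \<in> cball z r \<Longrightarrow>
          exp (f x $ i) - exp (f y $ i) \<le> L * norm (x - y)"
    and \<delta>: "0 < \<delta>" "\<delta> \<le> r"
  obtains k x X where "k > 0" "x \<in> \<Omega>" "dist x z < \<delta>" "\<And>i. dist (X $ i) z < \<delta>"
    "\<And>i. k * norm (X $ i - x) \<le> L"
    "\<And>i u. u \<in> cball z r \<Longrightarrow>
       exp (f (X $ i) $ i) + k * (norm (X $ i - x))\<^sup>2 \<le> exp (f u $ i) + k * (norm (u - x))\<^sup>2"
    "\<And>u. u \<in> \<Omega> \<Longrightarrow> u \<in> cball z r \<Longrightarrow>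
       (\<Sum>i\<in>UNIV. k * (norm (X $ i - x))\<^sup>2) + g x + (norm (x - z))\<^sup>2
         \<le> (\<Sum>i\<in>UNIV. k * (norm (X $ i - u))\<^sup>2) + g u + (norm (u - z))\<^sup>2"
proof -
  define m where "m = real CARD('m)"
  have m: "m > 0" by (simp add: m_def)
  \<comment> \<open>The first summand gives \<open>L / k < \<delta> / 2\<close>, which keeps each
    \<open>X $ i\<close> close to \<open>x\<close>; the second gives
    \<open>m * L\<^sup>2 / k < (\<delta> / 2)\<^sup>2\<close>, which keeps \<open>x\<close> close to
    \<open>z\<close>.\<close>
  define k where "k = 4 * L / \<delta> + 8 * m * L\<^sup>2 / \<delta>\<^sup>2"
  have k: "k > 0" using L \<delta> m by (simp add: k_def add_pos_nonneg)
  have k1: "L / k < \<delta> / 2"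
  proof -
    have "4 * L / \<delta> \<le> k" using m by (simp add: k_def)
    then have "2 * L < \<delta> * k" using L \<delta> by (simp add: field_simps)
    then show ?thesis using k by (simp add: field_simps)
  qed
  have k2: "m * L\<^sup>2 / k < (\<delta> / 2)\<^sup>2"
  proof -
    have "8 * m * L\<^sup>2 / \<delta>\<^sup>2 \<le> k" using L \<delta> by (simp add: k_def)
    then have "8 * (m * L\<^sup>2) \<le> \<delta>\<^sup>2 * k" using \<delta> by (simp add: field_simps)
    moreover have "m * L\<^sup>2 > 0" using m L by simp
    ultimately have "4 * (m * L\<^sup>2) < \<delta>\<^sup>2 * k" by linarith
    then show ?thesis using k by (simp add: field_simps)
  qed
  define P :: "'a set" where "P = \<Omega> \<inter> cball z r"
  define Q :: "('a^'m) set" where "Q = {X. \<forall>i. X $ i \<in> cball z r}"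
  define H where "H = (\<lambda>(x, X :: 'a^'m). (\<Sum>i\<in>UNIV. exp (f (X $ i) $ i) + k * (norm (X $ i - x))\<^sup>2)
      + g x + (norm (x - z))\<^sup>2)"
  have "compact P" unfolding P_def using \<Omega> by (intro closed_Int_compact) auto
  moreover have "compact Q"
  proof -
    have "closed Q" unfolding Q_def mem_cball
      by (intro closed_Collect_all closed_Collect_le continuous_intros)
    moreover have "norm X \<le> m * (norm z + r)" if "X \<in> Q" for X
    proof -
      have "norm X \<le> (\<Sum>i\<in>UNIV. norm (X $ i))" unfolding norm_vec_def by (rule L2_set_le_sum) auto
      also have "\<dots> \<le> (\<Sum>i\<in>(UNIV::'m set). norm z + r)"
      proof (rule sum_mono)
        fix i
        have "norm (X $ i) \<le> norm z + norm (X $ i - z)" using norm_triangle_ineq[of z "X $ i - z"] by simp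
        moreover have "norm (X $ i - z) \<le> r" using that by (simp add: Q_def dist_norm norm_minus_commute)
        ultimately show "norm (X $ i) \<le> norm z + r" by linarith
      qed
      finally show ?thesis by (simp add: m_def)
    qed
    ultimately show ?thesis by (meson boundedI compact_eq_bounded_closed)
  qed
  ultimately have "compact (P \<times> Q)" by (rule compact_Times)
  moreover have zin: "(z, \<chi> i. z) \<in> P \<times> Q" using \<Omega> \<delta> by (simp add: P_def Q_def)
  moreover have "continuous_on (P \<times> Q) H"
  proof -
    have fc: "continuous_on UNIV f" by (rule locally_lipschitz_imp_continuous_on[OF f])
    show ?thesis unfolding H_def case_prod_unfold
      by (intro continuous_intros continuous_on_compose2[OF fc] continuous_on_compose2[OF g]) auto
  qed
  ultimately obtain x X where xX: "x \<in> P" "X \<in> Q"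
    and xmin: "\<And>u U. u \<in> P \<Longrightarrow> U \<in> Q \<Longrightarrow> H (x, X) \<le> H (u, U)"
    using continuous_attains_inf[of "P \<times> Q" H] by blast
  have xr: "x \<in> cball z r" "x \<in> \<Omega>" using xX by (auto simp: P_def)
  \<comment> \<open>Only the coordinate \<open>i\<close> of \<open>X\<close> is changed, so all
    other summands cancel.\<close>
  have Xmin: "exp (f (X $ i) $ i) + k * (norm (X $ i - x))\<^sup>2 \<le> exp (f u $ i) + k * (norm (u - x))\<^sup>2"
    if "u \<in> cball z r" for i u
  proof -
    define U where "U = (\<chi> j. if j = i then u else X $ j)"
    have "U \<in> Q" using that xX by (auto simp: Q_def U_def)
    from xmin[OF xX(1) this]
    have "(\<Sum>j\<in>UNIV. exp (f (X $ j) $ j) + k * (norm (X $ j - x))\<^sup>2)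
        \<le> (\<Sum>j\<in>UNIV. exp (f (U $ j) $ j) + k * (norm (U $ j - x))\<^sup>2)"
      by (simp add: H_def)
    moreover have "(\<Sum>j\<in>UNIV - {i}. exp (f (X $ j) $ j) + k * (norm (X $ j - x))\<^sup>2)
        = (\<Sum>j\<in>UNIV - {i}. exp (f (U $ j) $ j) + k * (norm (U $ j - x))\<^sup>2)"
      by (rule sum.cong) (auto simp: U_def)
    ultimately have "exp (f (X $ i) $ i) + k * (norm (X $ i - x))\<^sup>2
        \<le> exp (f (U $ i) $ i) + k * (norm (U $ i - x))\<^sup>2"
      using sum.remove[of UNIV i "\<lambda>j. exp (f (X $ j) $ j) + k * (norm (X $ j - x))\<^sup>2"]
        sum.remove[of UNIV i "\<lambda>j. exp (f (U $ j) $ j) + k * (norm (U $ j - x))\<^sup>2"]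
      by simp
    then show ?thesis by (simp add: U_def)
  qed
  \<comment> \<open>Taking \<open>u = x\<close> above bounds a quadratic term by a linear one;
    dividing by the distance leaves a bound independent of \<open>k\<close>.\<close>
  have kX: "k * norm (X $ i - x) \<le> L" for i
  proof -
    have "exp (f x $ i) - exp (f (X $ i) $ i) \<le> L * norm (x - X $ i)"
      using xX xr by (intro L) (auto simp: Q_def)
    with Xmin[OF xr(1), of i] have "(k * norm (X $ i - x)) * norm (X $ i - x) \<le> L * norm (X $ i - x)"
      by (simp add: power2_eq_square norm_minus_commute)
    then show ?thesis using L by (cases "X $ i = x") auto
  qed
  have close: "norm (X $ i - x) \<le> L / k" for i
    using kX[of i] k by (simp add: field_simps)
  \<comment> \<open>Replacing every \<open>X $ i\<close> by \<open>x\<close> costs at most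
    \<open>L * (L / k)\<close> per component, and \<open>z\<close> minimizes the unpenalized
    function, so \<open>(norm (x - z))\<^sup>2\<close> is at most
    \<open>m * L\<^sup>2 / k\<close>.\<close>
  have xz: "norm (x - z) < \<delta> / 2"
  proof -
    have "(\<Sum>i\<in>UNIV. exp (f x $ i) - L * (L / k)) \<le> (\<Sum>i\<in>UNIV. exp (f (X $ i) $ i) + k * (norm (X $ i - x))\<^sup>2)"
    proof (rule sum_mono)
      fix i
      have "exp (f x $ i) - exp (f (X $ i) $ i) \<le> L * norm (x - X $ i)"
        using xX xr by (intro L) (auto simp: Q_def)
      also have "\<dots> \<le> L * (L / k)"
        using close[of i] L by (intro mult_left_mono) (auto simp: norm_minus_commute)
      finally show "exp (f x $ i) - L * (L / k) \<le> exp (f (X $ i) $ i) + k * (norm (X $ i - x))\<^sup>2"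
        using k by (smt (verit) zero_le_mult_iff zero_le_power2)
    qed
    then have "(\<Sum>i\<in>UNIV. exp (f x $ i)) - m * L\<^sup>2 / k + g x + (norm (x - z))\<^sup>2 \<le> H (x, X)"
      by (simp add: sum_subtractf m_def H_def power2_eq_square)
    also have "H (x, X) \<le> H (z, \<chi> i. z)" using xmin zin by blast
    also have "\<dots> = (\<Sum>i\<in>UNIV. exp (f z $ i)) + g z" by (simp add: H_def)
    also have "\<dots> \<le> (\<Sum>i\<in>UNIV. exp (f x $ i)) + g x" by (rule min[OF xr(2,1)])
    finally have "(norm (x - z))\<^sup>2 < (\<delta> / 2)\<^sup>2" using k2 by linarith
    then show ?thesis using \<delta> power_less_imp_less_base by fastforce
  qed
  have Xz: "norm (X $ i - z) < \<delta>" for i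
  proof -
    have "norm (X $ i - z) \<le> norm (X $ i - x) + norm (x - z)"
      using norm_triangle_ineq[of "X $ i - x" "x - z"] by simp
    then show ?thesis using close[of i] xz k1 by linarith
  qed
  show ?thesis
  proof (rule that[OF k xr(2) _ _ kX Xmin])
    show "dist x z < \<delta>" using xz \<delta> by (simp add: dist_norm)
    show "\<And>i. dist (X $ i) z < \<delta>" using Xz by (simp add: dist_norm)
    fix u assume "u \<in> \<Omega>" "u \<in> cball z r"
    then have "H (x, X) \<le> H (u, X)" using xX by (intro xmin) (auto simp: P_def)
    then show "(\<Sum>i\<in>UNIV. k * (norm (X $ i - x))\<^sup>2) + g x + (norm (x - z))\<^sup>2
         \<le> (\<Sum>i\<in>UNIV. k * (norm (X $ i - u))\<^sup>2) + g u + (norm (u - z))\<^sup>2"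
      by (simp add: H_def sum.distrib)
  qed
qed

lemma norm_sq_has_derivative:
  fixes x a :: "'a::real_inner"
  shows "((\<lambda>u. c * (norm (u - a))\<^sup>2) has_derivative (\<lambda>d. ((2 * c) *\<^sub>R (x - a)) \<bullet> d)) (at x)"
  unfolding power2_norm_eq_inner
  by (auto intro!: derivative_eq_intros simp: inner_commute algebra_simps)

text \<open>Approximate sum rule: the first-order conditions of the decoupled minimizer in the
  variables \<open>X $ i\<close> and \<open>x\<close>. The penalty gradients in the two kinds of
  conditions are opposite, so adding them eliminates \<open>k\<close>.\<close>

lemma exp_sum_fuzzy_stationary:
  fixes f :: "'a::euclidean_space \<Rightarrow> real^'m"
  assumes f: "locally_lipschitz f" and \<Omega>: "closed \<Omega>" "z \<in> \<Omega>"
    and g: "\<And>x. (g has_derivative (\<lambda>d. G x \<bullet> d)) (at x)"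
    and min: "\<And>x. x \<in> \<Omega> \<Longrightarrow> x \<in> cball z r \<Longrightarrow>
       (\<Sum>i\<in>UNIV. exp (f z $ i)) + g z \<le> (\<Sum>i\<in>UNIV. exp (f x $ i)) + g x"
    and L: "L > 0"
       "\<And>x y i. x \<in> cball z r \<Longrightarrow> y \<in> cball z r \<Longrightarrow>
          exp (f x $ i) - exp (f y $ i) \<le> L * norm (x - y)"
    and b: "b > 0" "\<And>x i. x \<in> cball z r \<Longrightarrow> b \<le> exp (f x $ i)"
    and \<delta>: "0 < \<delta>" "\<delta> \<le> r"
  obtains x and X V :: "'a^'m" and w where
    "x \<in> \<Omega>" "dist x z < \<delta>" "\<And>i. dist (X $ i) z < \<delta>" "\<And>i. norm (V $ i) \<le> 2 * L / b"
    "\<And>i. (V $ i, -1) \<in> regular_normal_cone (X $ i, f (X $ i) $ i) (epigraph UNIV (\<lambda>x. f x $ i))"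
    "w \<in> regular_normal_cone x \<Omega>"
    "(\<Sum>i\<in>UNIV. exp (f (X $ i) $ i) *\<^sub>R (V $ i)) + G x + 2 *\<^sub>R (x - z) + w = 0"
proof -
  have gc: "continuous_on UNIV g"
    by (intro continuous_at_imp_continuous_on ballI has_derivative_continuous[OF g])
  show ?thesis
  proof (rule exp_sum_penalized_minimizer[OF f \<Omega> gc min L \<delta>])
    fix k x and X :: "'a^'m"
    assume k: "k > 0" and x: "x \<in> \<Omega>" "dist x z < \<delta>"
      and X: "\<And>i. dist (X $ i) z < \<delta>" "\<And>i. k * norm (X $ i - x) \<le> L"
      and Xmin: "\<And>i u. u \<in> cball z r \<Longrightarrow>
         exp (f (X $ i) $ i) + k * (norm (X $ i - x))\<^sup>2 \<le> exp (f u $ i) + k * (norm (u - x))\<^sup>2"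
      and xmin: "\<And>u. u \<in> \<Omega> \<Longrightarrow> u \<in> cball z r \<Longrightarrow>
         (\<Sum>i\<in>UNIV. k * (norm (X $ i - x))\<^sup>2) + g x + (norm (x - z))\<^sup>2
           \<le> (\<Sum>i\<in>UNIV. k * (norm (X $ i - u))\<^sup>2) + g u + (norm (u - z))\<^sup>2"
    \<comment> \<open>Such \<open>y\<close> is interior to the ball because
      \<open>\<delta> \<le> r\<close>, so minimality over the ball is local minimality.\<close>
    have near: "\<forall>\<^sub>F u in nhds y. u \<in> cball z r" if "dist y z < \<delta>" for y
    proof -
      have "\<forall>\<^sub>F u in nhds y. u \<in> ball z r"
        using that \<delta> by (intro eventually_nhds_in_open) (auto simp: dist_commute)
      then show ?thesis by eventually_elim auto
    qed
    \<comment> \<open>Minus the penalty gradient at \<open>X $ i\<close>, divided by the factor that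
      the chain rule for \<open>exp\<close> produces.\<close>
    define V where "V = (\<chi> i. - (1 / exp (f (X $ i) $ i)) *\<^sub>R ((2 * k) *\<^sub>R (X $ i - x)))"
    \<comment> \<open>Gradient at \<open>x\<close> of the objective as a function of the point of
      \<open>\<Omega>\<close> alone.\<close>
    define Q where "Q = (\<Sum>i\<in>UNIV. (2 * k) *\<^sub>R (x - X $ i)) + G x + 2 *\<^sub>R (x - z)"
    show ?thesis
    proof (rule that[OF x X(1)])
      fix i
      have "(- (1 / exp (f (X $ i) $ i)) *\<^sub>R ((2 * k) *\<^sub>R (X $ i - x)), -1)
          \<in> regular_normal_cone (X $ i, f (X $ i) $ i) (epigraph UNIV (\<lambda>x. f x $ i))"
      proof (rule regular_normal_epigraph_of_exp_min[OF norm_sq_has_derivative])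
        show "\<forall>\<^sub>F u in nhds (X $ i). exp (f (X $ i) $ i) + k * (norm (X $ i - x))\<^sup>2
                \<le> exp (f u $ i) + k * (norm (u - x))\<^sup>2"
          using near[OF X(1)[of i]] by eventually_elim (rule Xmin)
      qed
      then show "(V $ i, -1) \<in> regular_normal_cone (X $ i, f (X $ i) $ i) (epigraph UNIV (\<lambda>x. f x $ i))"
        by (simp add: V_def)
      have "X $ i \<in> cball z r" using X(1)[of i] \<delta> by (simp add: dist_commute)
      then have "(2 * (k * norm (X $ i - x))) / exp (f (X $ i) $ i) \<le> (2 * L) / b"
        using X(2)[of i] b k L(1) by (intro frac_le) auto
      then show "norm (V $ i) \<le> 2 * L / b" using k by (simp add: V_def)
    next
      show "- Q \<in> regular_normal_cone x \<Omega>"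
      proof (rule regular_normal_of_local_min)
        have "((\<lambda>u. (\<Sum>i\<in>UNIV. k * (norm (u - X $ i))\<^sup>2) + g u + 1 * (norm (u - z))\<^sup>2) has_derivative
            (\<lambda>d. (\<Sum>i\<in>UNIV. ((2 * k) *\<^sub>R (x - X $ i)) \<bullet> d) + G x \<bullet> d + ((2 * 1) *\<^sub>R (x - z)) \<bullet> d)) (at x)"
          by (intro has_derivative_add has_derivative_sum norm_sq_has_derivative g)
        moreover have "(\<lambda>d. (\<Sum>i\<in>UNIV. ((2 * k) *\<^sub>R (x - X $ i)) \<bullet> d) + G x \<bullet> d + ((2 * 1) *\<^sub>R (x - z)) \<bullet> d)
            = (\<lambda>d. Q \<bullet> d)"
          unfolding Q_def inner_add_left inner_sum_left by simp
        ultimately show "((\<lambda>u. (\<Sum>i\<in>UNIV. k * (norm (X $ i - u))\<^sup>2) + g u + (norm (u - z))\<^sup>2) has_derivative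
            (\<lambda>d. Q \<bullet> d)) (at x)"
          by (simp add: norm_minus_commute)
        have "\<forall>\<^sub>F u in at x within \<Omega>. u \<in> cball z r"
          using near[OF x(2)] by (simp add: eventually_at_filter eventually_mono)
        moreover have "\<forall>\<^sub>F u in at x within \<Omega>. u \<in> \<Omega>" by (simp add: eventually_at_filter)
        ultimately show "\<forall>\<^sub>F u in at x within \<Omega>.
           (\<Sum>i\<in>UNIV. k * (norm (X $ i - x))\<^sup>2) + g x + (norm (x - z))\<^sup>2
           \<le> (\<Sum>i\<in>UNIV. k * (norm (X $ i - u))\<^sup>2) + g u + (norm (u - z))\<^sup>2"
          by eventually_elim (rule xmin)
      qed
      have "exp (f (X $ i) $ i) *\<^sub>R (V $ i) = (2 * k) *\<^sub>R (x - X $ i)" for i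
        by (simp add: V_def algebra_simps)
      then show "(\<Sum>i\<in>UNIV. exp (f (X $ i) $ i) *\<^sub>R (V $ i)) + G x + 2 *\<^sub>R (x - z) + - Q = 0"
        by (simp add: Q_def)
    qed
  qed
qed

text \<open>Exact sum rule, by letting \<open>\<delta>\<close> tend to 0 in the approximate one. The
  bound \<open>2 * L / b\<close> does not involve \<open>\<delta>\<close>, so the subgradients have
  a convergent subsequence, and limits of regular normals are limiting normals.\<close>

lemma exp_sum_local_min_stationary:
  fixes f :: "'a::euclidean_space \<Rightarrow> real^'m"
  assumes f: "locally_lipschitz f" and \<Omega>: "closed \<Omega>" "z \<in> \<Omega>"
    and g: "\<And>x. (g has_derivative (\<lambda>d. G x \<bullet> d)) (at x)" and G: "isCont G z"
    and \<rho>: "\<rho> > 0"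
    and min: "\<And>x. x \<in> \<Omega> \<Longrightarrow> dist x z < \<rho> \<Longrightarrow>
       (\<Sum>i\<in>UNIV. exp (f z $ i)) + g z \<le> (\<Sum>i\<in>UNIV. exp (f x $ i)) + g x"
  shows "\<exists>v w. (\<forall>i. v i \<in> limiting_subdifferential (\<lambda>x. f x $ i) z) \<and>
    w \<in> limiting_normal_cone z \<Omega> \<and>
    (\<Sum>i\<in>UNIV. exp (f z $ i) *\<^sub>R v i) + G z + w = 0"
proof -
  obtain r0 L b where r0: "r0 > 0" and L: "L > 0" and b: "b > 0" and
    Lip: "\<And>x y i. x \<in> cball z r0 \<Longrightarrow> y \<in> cball z r0 \<Longrightarrow>
       exp (f x $ i) - exp (f y $ i) \<le> L * norm (x - y)" and
    low: "\<And>x i. x \<in> cball z r0 \<Longrightarrow> b \<le> exp (f x $ i)"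
    using exp_component_local_bounds[OF f] by metis
  \<comment> \<open>Half of \<open>\<rho>\<close>, because minimality is assumed for distances
    strictly below \<open>\<rho>\<close> while \<open>r\<close> is the radius of a closed
    ball.\<close>
  define r where "r = min r0 (\<rho> / 2)"
  have r: "r > 0" using r0 \<rho> by (simp add: r_def)
  define \<delta> where "\<delta> n = r / real (Suc n)" for n
  have \<delta>: "0 < \<delta> n" "\<delta> n \<le> r" for n using r by (auto simp: \<delta>_def field_simps)
  have \<delta>0: "\<delta> \<longlonglongrightarrow> 0" unfolding \<delta>_def using LIMSEQ_Suc lim_const_over_n by blast
  define P where "P n x X V w \<longleftrightarrow> x \<in> \<Omega> \<and> dist x z < \<delta> n \<and> (\<forall>i. dist (X $ i) z < \<delta> n) \<and>
      (\<forall>i. norm (V $ i) \<le> 2 * L / b) \<and>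
      (\<forall>i. (V $ i, -1) \<in> regular_normal_cone (X $ i, f (X $ i) $ i) (epigraph UNIV (\<lambda>x. f x $ i))) \<and>
      w \<in> regular_normal_cone x \<Omega> \<and>
      (\<Sum>i\<in>UNIV. exp (f (X $ i) $ i) *\<^sub>R (V $ i)) + G x + 2 *\<^sub>R (x - z) + w = 0"
    for n x and X V :: "'a^'m" and w
  have "\<exists>x X V w. P n x X V w" for n
  proof -
    have sub: "cball z r \<subseteq> cball z r0" by (auto simp: r_def)
    have min': "(\<Sum>i\<in>UNIV. exp (f z $ i)) + g z \<le> (\<Sum>i\<in>UNIV. exp (f x $ i)) + g x"
      if "x \<in> \<Omega>" "x \<in> cball z r" for x
      using that \<rho> by (intro min) (auto simp: r_def dist_commute)
    have Lip': "exp (f x $ i) - exp (f y $ i) \<le> L * norm (x - y)"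
      if "x \<in> cball z r" "y \<in> cball z r" for x y i
      using Lip that sub by blast
    have low': "b \<le> exp (f x $ i)" if "x \<in> cball z r" for x i
      using low that sub by blast
    show ?thesis
    proof (rule exp_sum_fuzzy_stationary[OF f \<Omega> g min' L Lip' b low' \<delta>[of n]])
      fix x :: 'a and X V :: "'a^'m" and w
      assume "x \<in> \<Omega>" "dist x z < \<delta> n" "\<And>i. dist (X $ i) z < \<delta> n" "\<And>i. norm (V $ i) \<le> 2 * L / b"
        "\<And>i. (V $ i, -1) \<in> regular_normal_cone (X $ i, f (X $ i) $ i) (epigraph UNIV (\<lambda>x. f x $ i))"
        "w \<in> regular_normal_cone x \<Omega>"
        "(\<Sum>i\<in>UNIV. exp (f (X $ i) $ i) *\<^sub>R (V $ i)) + G x + 2 *\<^sub>R (x - z) + w = 0"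
      then show ?thesis
        unfolding P_def by (intro exI[of _ x] exI[of _ X] exI[of _ V] exI[of _ w] conjI allI)
    qed
  qed
  then obtain x X V w where all: "\<And>n. P n (x n) (X n) (V n) (w n)" by metis
  have
    x: "\<And>n. x n \<in> \<Omega>" "\<And>n. dist (x n) z < \<delta> n" and
    X: "\<And>n i. dist (X n $ i) z < \<delta> n" and
    V: "\<And>n i. norm (V n $ i) \<le> 2 * L / b"
       "\<And>n i. (V n $ i, -1) \<in> regular_normal_cone (X n $ i, f (X n $ i) $ i) (epigraph UNIV (\<lambda>x. f x $ i))" and
    w: "\<And>n. w n \<in> regular_normal_cone (x n) \<Omega>" and
    eq: "\<And>n. (\<Sum>i\<in>UNIV. exp (f (X n $ i) $ i) *\<^sub>R (V n $ i)) + G (x n) + 2 *\<^sub>R (x n - z) + w n = 0"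
    using all unfolding P_def by blast+
  have xz: "x \<longlonglongrightarrow> z"
    by (rule metric_tendsto_imp_tendsto[OF \<delta>0]) (auto intro!: always_eventually less_imp_le simp: x \<delta> abs_of_pos)
  have Xz: "(\<lambda>n. X n $ i) \<longlonglongrightarrow> z" for i
    by (rule metric_tendsto_imp_tendsto[OF \<delta>0]) (auto intro!: always_eventually less_imp_le simp: X \<delta> abs_of_pos)
  have "norm (V n) \<le> real CARD('m) * (2 * L / b)" for n
  proof -
    have "norm (V n) \<le> (\<Sum>i\<in>UNIV. norm (V n $ i))" unfolding norm_vec_def by (rule L2_set_le_sum) auto
    also have "\<dots> \<le> (\<Sum>i\<in>(UNIV::'m set). 2 * L / b)" by (intro sum_mono V)
    finally show ?thesis by simp
  qed
  then have "bounded (range V)" by (intro boundedI[where B = "real CARD('m) * (2 * L / b)"]) auto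
  then obtain V0 s where s: "strict_mono s" and V0: "(V \<circ> s) \<longlonglongrightarrow> V0"
    using bounded_imp_convergent_subsequence by blast
  have VV: "(\<lambda>n. V (s n) $ i) \<longlonglongrightarrow> V0 $ i" for i
    using tendsto_vec_nth[OF V0] by (simp add: o_def)
  have xs: "(\<lambda>n. x (s n)) \<longlonglongrightarrow> z" and Xs: "(\<lambda>n. X (s n) $ i) \<longlonglongrightarrow> z" for i
    using LIMSEQ_subseq_LIMSEQ[OF xz s] LIMSEQ_subseq_LIMSEQ[OF Xz s] by (auto simp: o_def)
  have "isCont f z" using locally_lipschitz_imp_continuous_on[OF f, of UNIV]
    by (simp add: continuous_on_eq_continuous_at)
  then have fX: "(\<lambda>n. f (X (s n) $ i) $ i) \<longlonglongrightarrow> f z $ i" for i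
    using isCont_tendsto_compose Xs tendsto_vec_nth by blast
  show ?thesis
  proof (intro exI[of _ "\<lambda>i. V0 $ i"] exI[of _ "- ((\<Sum>i\<in>UNIV. exp (f z $ i) *\<^sub>R (V0 $ i)) + G z)"]
      conjI allI)
    fix i
    show "V0 $ i \<in> limiting_subdifferential (\<lambda>x. f x $ i) z"
      unfolding limiting_subdifferential_def limiting_normal_cone_def
    proof (intro CollectI exI conjI allI)
      let ?p = "\<lambda>n. (X (s n) $ i, f (X (s n) $ i) $ i)"
      show "?p n \<in> epigraph UNIV (\<lambda>x. f x $ i)" for n
        by (simp add: mem_epigraph)
      show "(V (s n) $ i, -1) \<in> regular_normal_cone (?p n) (epigraph UNIV (\<lambda>x. f x $ i))" for n
        by (rule V)
      show "?p \<longlonglongrightarrow> (z, f z $ i)" by (intro tendsto_Pair Xs fX)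
      show "(\<lambda>n. (V (s n) $ i, - 1 :: real)) \<longlonglongrightarrow> (V0 $ i, - 1)"
        by (intro tendsto_Pair VV tendsto_const)
    qed
  next
    \<comment> \<open>The normals converge because the stationarity equation expresses them through
      convergent quantities.\<close>
    let ?w = "\<lambda>n. - ((\<Sum>i\<in>UNIV. exp (f (X (s n) $ i) $ i) *\<^sub>R (V (s n) $ i)) + G (x (s n)) + 2 *\<^sub>R (x (s n) - z))"
    have "?w \<longlonglongrightarrow> - ((\<Sum>i\<in>UNIV. exp (f z $ i) *\<^sub>R (V0 $ i)) + G z + 2 *\<^sub>R (z - z))"
      by (intro tendsto_intros fX VV xs isCont_tendsto_compose[OF G])
    moreover have "?w = (\<lambda>n. w (s n))"
    proof
      fix n show "?w n = w (s n)" by (rule minus_unique[OF eq])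
    qed
    ultimately show "- ((\<Sum>i\<in>UNIV. exp (f z $ i) *\<^sub>R (V0 $ i)) + G z) \<in> limiting_normal_cone z \<Omega>"
      unfolding limiting_normal_cone_def using x w xs
      by (intro CollectI exI[of _ "\<lambda>n. x (s n)"] exI[of _ "\<lambda>n. w (s n)"]) auto
  qed simp
qed

section \<open>Values bounded by the recession condition\<close>

text \<open>If no \<open>C\<close> works, there are points of \<open>Y\<close> with norms tending to
  infinity whose positive parts are negligible against these norms. Their normalizations accumulate
  at a unit vector of the recession cone without positive components, which the hypothesis
  excludes.\<close>

lemma norm_le_some_component:
  fixes Y :: "(real^'m) set"
  assumes "recession_cone Y \<inter> uminus ` nonneg_orthant \<subseteq> {0}"
  shows "\<exists>C>0. \<forall>y\<in>Y. \<exists>j. norm y \<le> C * (1 + max 0 (y $ j))"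
proof (rule ccontr)
  assume "\<not> ?thesis"
  then have "\<exists>y\<in>Y. \<forall>j. norm y > real (Suc n) * (1 + max 0 (y $ j))" for n
    by (meson not_le of_nat_0_less_iff zero_less_Suc)
  then obtain y where yY: "\<And>n. y n \<in> Y"
    and y: "\<And>n j. norm (y n) > real (Suc n) * (1 + max 0 (y n $ j))"
    by metis
  \<comment> \<open>The summand 1 forces the norms to infinity; any index serves here, and
    \<open>undefined\<close> names one.\<close>
  have big: "norm (y n) > real (Suc n)" for n
  proof -
    have "real (Suc n) * 1 \<le> real (Suc n) * (1 + max 0 (y n $ undefined))"
      by (intro mult_left_mono) auto
    also have "\<dots> < norm (y n)" by (rule y)
    finally show ?thesis by simp
  qed
  define t where "t n = 1 / norm (y n)" for n
  have ny: "norm (y n) > 0" for n using big[of n] by (smt (verit) of_nat_0_le_iff)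
  have inv: "(\<lambda>n. 1 / real (Suc n)) \<longlonglongrightarrow> 0" using LIMSEQ_Suc lim_const_over_n by blast
  have t0: "t \<longlonglongrightarrow> 0"
  proof (rule tendsto_sandwich[OF _ _ tendsto_const inv])
    show "\<forall>\<^sub>F n in sequentially. t n \<le> 1 / real (Suc n)"
      unfolding t_def using big by (intro always_eventually allI frac_le) (auto intro: less_imp_le)
  qed (auto simp: t_def)
  have "bounded (range (\<lambda>n. t n *\<^sub>R y n))"
    using ny by (intro boundedI[of _ 1]) (auto simp: t_def)
  then obtain d s where s: "strict_mono s" and d: "((\<lambda>n. t n *\<^sub>R y n) \<circ> s) \<longlonglongrightarrow> d"
    using bounded_imp_convergent_subsequence by blast
  then have d': "(\<lambda>n. t (s n) *\<^sub>R y (s n)) \<longlonglongrightarrow> d" by (simp add: o_def)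
  have "(\<lambda>n. norm (t (s n) *\<^sub>R y (s n))) = (\<lambda>n. 1)"
    using ny by (auto simp: t_def less_imp_neq)
  with tendsto_norm[OF d'] have "norm d = 1"
    using LIMSEQ_unique tendsto_const by metis
  moreover have "d \<in> recession_cone Y"
    unfolding recession_cone_def
  proof (intro CollectI exI conjI allI)
    show "(\<lambda>n. t (s n)) \<longlonglongrightarrow> 0" using LIMSEQ_subseq_LIMSEQ[OF t0 s] by (simp add: o_def)
  qed (use yY d' in \<open>auto simp: t_def\<close>)
  moreover have "d $ j \<le> 0" for j
  proof (rule LIMSEQ_le[OF tendsto_vec_nth[OF d', of j] LIMSEQ_subseq_LIMSEQ[OF inv s]])
    have "(t n *\<^sub>R y n) $ j \<le> 1 / real (Suc n)" for n
    proof -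
      have "real (Suc n) * (y n $ j) \<le> real (Suc n) * (1 + max 0 (y n $ j))"
        by (intro mult_left_mono) auto
      then have "real (Suc n) * (y n $ j) \<le> norm (y n)" using y[of n j] by linarith
      then show ?thesis using ny[of n] by (simp add: t_def field_simps del: of_nat_Suc)
    qed
    then show "\<exists>N. \<forall>n\<ge>N. (t (s n) *\<^sub>R y (s n)) $ j \<le> ((\<lambda>n. 1 / real (Suc n)) \<circ> s) n"
      by auto
  qed
  then have "d \<in> uminus ` nonneg_orthant"
    by (intro image_eqI[of _ _ "- d"]) (auto simp: nonneg_orthant_def)
  ultimately show False using assms by auto
qed

section \<open>The exponential scalarization\<close>

text \<open>Defined on value vectors rather than on points, so that it also applies to limits of
  values and to order bounds.\<close>

definition exp_sum :: "real^'m \<Rightarrow> real" where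
  "exp_sum y = (\<Sum>i\<in>UNIV. exp (y $ i))"

lemma exp_sum_pos: "exp_sum y > 0"
  unfolding exp_sum_def by (intro sum_pos) auto

lemma exp_le_exp_sum: "exp (y $ i) \<le> exp_sum y"
  unfolding exp_sum_def by (intro member_le_sum) auto

lemma exp_sum_mono: "y \<le> y' \<Longrightarrow> exp_sum y \<le> exp_sum y'"
  unfolding exp_sum_def by (intro sum_mono) (simp add: less_eq_vec_def)

lemma tendsto_exp_sum: "(g \<longlongrightarrow> y) F \<Longrightarrow> ((\<lambda>x. exp_sum (g x)) \<longlongrightarrow> exp_sum y) F"
  unfolding exp_sum_def by (intro tendsto_intros)

lemma continuous_on_exp_sum:
  assumes "locally_lipschitz f" shows "continuous_on A (\<lambda>x. exp_sum (f x))"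
  unfolding exp_sum_def
  by (intro continuous_intros locally_lipschitz_imp_continuous_on[OF assms])

lemma component_le_ln_exp_sum:
  assumes "exp_sum y \<le> c" shows "y $ i \<le> ln c"
proof -
  have "exp (y $ i) \<le> c" using exp_le_exp_sum[of y i] assms by linarith
  then show ?thesis by (metis exp_gt_zero ln_exp ln_mono)
qed

text \<open>A bound on \<open>exp_sum\<close> controls the components only from above, by
  \<open>ln c\<close>; the recession condition turns this into a bound on the norm.\<close>

lemma exp_sum_sublevel_norm_bounded:
  fixes Y :: "(real^'m) set"
  assumes "recession_cone Y \<inter> uminus ` nonneg_orthant \<subseteq> {0}"
  obtains B where "\<And>y. y \<in> Y \<Longrightarrow> exp_sum y \<le> c \<Longrightarrow> norm y \<le> B"
proof -
  obtain C where C: "C > 0" "\<forall>y\<in>Y. \<exists>j. norm y \<le> C * (1 + max 0 (y $ j))"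
    using norm_le_some_component[OF assms] by blast
  show ?thesis
  proof (rule that[of "C * (1 + max 0 (ln c))"])
    fix y assume y: "y \<in> Y" "exp_sum y \<le> c"
    then obtain j where "norm y \<le> C * (1 + max 0 (y $ j))" using C by blast
    also have "\<dots> \<le> C * (1 + max 0 (ln c))"
      using C component_le_ln_exp_sum[OF y(2), of j] by (intro mult_left_mono) auto
    finally show "norm y \<le> C * (1 + max 0 (ln c))" .
  qed
qed

section \<open>Properness and sequences escaping to infinity\<close>

lemma not_bounded_obtain_large:
  assumes "\<not> bounded S" obtains x where "x \<in> S" "norm x \<ge> R"
  using assms by (meson boundedI linear)

lemma norm_at_top_of_ge_nat:
  assumes "\<And>n. norm (x n) \<ge> real n"
  shows "filterlim (\<lambda>n. norm (x n)) at_top sequentially"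
  using filterlim_at_top_mono[OF filterlim_real_sequentially] assms by simp

lemma at_top_not_eventually_le:
  fixes a :: "nat \<Rightarrow> real"
  assumes "filterlim a at_top sequentially" and "\<forall>\<^sub>F n in sequentially. a n \<le> B"
  shows False
proof -
  have "\<forall>\<^sub>F n in sequentially. B < a n" using assms(1) by (simp add: filterlim_at_top_dense)
  with assms(2) have "\<forall>\<^sub>F n in sequentially. False" by eventually_elim simp
  then show False by simp
qed

text \<open>An unbounded sublevel set contains an escaping sequence whose values lie below the
  constant vector \<open>ln c\<close> and have bounded norm, against properness. Conversely, points
  with values below \<open>y\<close> lie in the sublevel set at \<open>exp_sum y\<close>; if that
  set is bounded, no such sequence escapes and properness holds vacuously.\<close>

lemma proper_on_iff_exp_sum_sublevels_bounded:
  fixes f :: "'a::real_normed_vector \<Rightarrow> real^'m"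
  assumes "recession_cone (f ` \<Omega>) \<inter> uminus ` nonneg_orthant \<subseteq> {0}"
  shows "proper_on f \<Omega> \<longleftrightarrow> (\<forall>c. bounded {x\<in>\<Omega>. exp_sum (f x) \<le> c})"
proof
  assume proper: "proper_on f \<Omega>"
  show "\<forall>c. bounded {x\<in>\<Omega>. exp_sum (f x) \<le> c}"
  proof (rule ccontr)
    assume "\<not> (\<forall>c. bounded {x\<in>\<Omega>. exp_sum (f x) \<le> c})"
    then obtain c where "\<not> bounded {x\<in>\<Omega>. exp_sum (f x) \<le> c}" by blast
    from not_bounded_obtain_large[OF this]
    have "\<exists>x. x \<in> \<Omega> \<and> exp_sum (f x) \<le> c \<and> norm x \<ge> real n" for n
      by (metis (no_types, lifting) mem_Collect_eq)
    then obtain x where x: "\<And>n. x n \<in> \<Omega>" "\<And>n. exp_sum (f (x n)) \<le> c" "\<And>n. norm (x n) \<ge> real n"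
      by metis
    have "f (x n) \<le> (\<chi> i. ln c)" for n
      using component_le_ln_exp_sum[OF x(2)] by (simp add: less_eq_vec_def)
    then have "filterlim (\<lambda>n. norm (f (x n))) at_top sequentially"
      using proper x(1) norm_at_top_of_ge_nat[OF x(3)]
      unfolding proper_on_def proper_at_sublevel_def by blast
    moreover obtain B where "\<And>y. y \<in> f ` \<Omega> \<Longrightarrow> exp_sum y \<le> c \<Longrightarrow> norm y \<le> B"
      using exp_sum_sublevel_norm_bounded[OF assms] by metis
    then have "\<forall>\<^sub>F n in sequentially. norm (f (x n)) \<le> B" using x by simp
    ultimately show False by (rule at_top_not_eventually_le)
  qed
next
  assume bdd: "\<forall>c. bounded {x\<in>\<Omega>. exp_sum (f x) \<le> c}"
  show "proper_on f \<Omega>"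
    unfolding proper_on_def proper_at_sublevel_def
  proof (intro allI impI, elim conjE)
    fix y and x :: "nat \<Rightarrow> 'a"
    assume x: "\<forall>k. x k \<in> \<Omega>" "filterlim (\<lambda>k. norm (x k)) at_top sequentially" "\<forall>k. f (x k) \<le> y"
    obtain B where "\<forall>x\<in>{x\<in>\<Omega>. exp_sum (f x) \<le> exp_sum y}. norm x \<le> B"
      using bdd unfolding bounded_iff by blast
    then have "norm (x k) \<le> B" for k using x(1,3) exp_sum_mono by blast
    then have "\<forall>\<^sub>F k in sequentially. norm (x k) \<le> B" by simp
    then have False by (rule at_top_not_eventually_le[OF x(2)])
    then show "filterlim (\<lambda>k. norm (f (x k))) at_top sequentially" ..
  qed
qed

lemma no_convergent_values_at_infinity:
  assumes bdd: "\<forall>c. bounded {x\<in>\<Omega>. exp_sum (f x) \<le> c}"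
    and x: "\<forall>k. x k \<in> \<Omega>" "filterlim (\<lambda>k. norm (x k)) at_top sequentially" "(\<lambda>k. f (x k)) \<longlonglongrightarrow> y"
  shows False
proof -
  \<comment> \<open>The slack 1 is there because the values only converge to \<open>y\<close>,
    possibly from levels above \<open>exp_sum y\<close>.\<close>
  obtain B where B: "\<forall>x\<in>{x\<in>\<Omega>. exp_sum (f x) \<le> exp_sum y + 1}. norm x \<le> B"
    using bdd unfolding bounded_iff by blast
  have "\<forall>\<^sub>F k in sequentially. exp_sum (f (x k)) < exp_sum y + 1"
    by (rule order_tendstoD[OF tendsto_exp_sum[OF x(3)]]) simp
  then have "\<forall>\<^sub>F k in sequentially. norm (x k) \<le> B"
    by eventually_elim (use B x(1) in auto)
  then show False by (rule at_top_not_eventually_le[OF x(2)])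
qed

lemma proper_imp_sets_at_infinity_empty:
  assumes "\<forall>c. bounded {x\<in>\<Omega>. exp_sum (f x) \<le> c}"
  shows "K_tilde_inf f \<Omega> = {}" "T_inf f \<Omega> = {}"
proof -
  show "K_tilde_inf f \<Omega> = {}"
    unfolding K_tilde_inf_def using no_convergent_values_at_infinity[OF assms] by blast
  have "Gamma_set f \<Omega> \<subseteq> \<Omega>" by (auto simp: Gamma_set_def)
  then show "T_inf f \<Omega> = {}"
    unfolding T_inf_def using no_convergent_values_at_infinity[OF assms] by blast
qed

section \<open>The Rabier function and the set Gamma at stationary points\<close>

lemma rabier_nonneg: "0 \<le> rabier f \<Omega> x"
  unfolding rabier_def by (intro Inf_greatest) auto

text \<open>Once \<open>norm (x k)\<close> is at least 1, the Rabier function lies between 0 and its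
  product with the norm.\<close>

lemma K_inf_subset_K_tilde_inf: "K_inf f \<Omega> \<subseteq> K_tilde_inf f \<Omega>"
proof
  fix y assume "y \<in> K_inf f \<Omega>"
  then obtain x where x: "\<forall>k. x k \<in> \<Omega>" "filterlim (\<lambda>k. norm (x k)) at_top sequentially"
    "(\<lambda>k. f (x k)) \<longlonglongrightarrow> y" and lim: "(\<lambda>k. ereal (norm (x k)) * rabier f \<Omega> (x k)) \<longlonglongrightarrow> 0"
    unfolding K_inf_def by blast
  have "\<forall>\<^sub>F k in sequentially. 1 \<le> norm (x k)"
    using x(2) by (simp add: filterlim_at_top)
  then have "\<forall>\<^sub>F k in sequentially. rabier f \<Omega> (x k) \<le> ereal (norm (x k)) * rabier f \<Omega> (x k)"
  proof eventually_elim
    case (elim k)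
    have "1 * rabier f \<Omega> (x k) \<le> ereal (norm (x k)) * rabier f \<Omega> (x k)"
      using elim by (intro ereal_mult_right_mono rabier_nonneg) simp
    then show ?case by simp
  qed
  then have "(\<lambda>k. rabier f \<Omega> (x k)) \<longlonglongrightarrow> 0"
    by (intro tendsto_sandwich[OF _ _ tendsto_const lim]) (simp_all add: rabier_nonneg)
  then show "y \<in> K_tilde_inf f \<Omega>" using x unfolding K_tilde_inf_def by blast
qed

text \<open>Dividing the stationarity equation by \<open>exp_sum (f z)\<close> makes the weights sum
  to one; the resulting combination in the infimum equals \<open>- g\<close> divided by
  \<open>exp_sum (f z)\<close>.\<close>

lemma rabier_le_of_stationary:
  assumes v: "\<forall>i. v i \<in> limiting_subdifferential (\<lambda>x. f x $ i) z"
    and w: "w \<in> limiting_normal_cone z \<Omega>"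
    and eq: "(\<Sum>i\<in>UNIV. exp (f z $ i) *\<^sub>R v i) + g + w = 0"
  shows "rabier f \<Omega> z \<le> ereal (norm g / exp_sum (f z))"
proof -
  define s where "s = 1 / exp_sum (f z)"
  have s: "s > 0" using exp_sum_pos by (simp add: s_def)
  let ?lam = "\<chi> i. s * exp (f z $ i)"
  have "(\<Sum>i\<in>UNIV. ?lam $ i *\<^sub>R v i) + s *\<^sub>R w = s *\<^sub>R ((\<Sum>i\<in>UNIV. exp (f z $ i) *\<^sub>R v i) + w)"
    by (simp add: scaleR_sum_right scaleR_add_right)
  also have "(\<Sum>i\<in>UNIV. exp (f z $ i) *\<^sub>R v i) + w = - g"
    using eq by (simp add: eq_neg_iff_add_eq_0 add.commute add.left_commute)
  finally have norm_eq: "norm ((\<Sum>i\<in>UNIV. ?lam $ i *\<^sub>R v i) + s *\<^sub>R w) = norm g / exp_sum (f z)"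
    using s by (simp add: s_def exp_sum_pos abs_of_pos)
  have "(\<Sum>i\<in>UNIV. ?lam $ i) = s * exp_sum (f z)" by (simp add: exp_sum_def sum_distrib_left)
  then have "(\<Sum>i\<in>UNIV. ?lam $ i) = 1" using exp_sum_pos[of "f z"] by (simp add: s_def)
  moreover have "?lam \<in> nonneg_orthant" using s by (simp add: nonneg_orthant_def)
  moreover have "\<forall>i. v i \<in> component_subgradients f z i" using v by (simp add: component_subgradients_def)
  moreover have "s *\<^sub>R w \<in> limiting_normal_cone z \<Omega>" using w s by (rule limiting_normal_cone_scaleR)
  ultimately show ?thesis
    unfolding rabier_def norm_eq[symmetric] by (intro Inf_lower) blast
qed

text \<open>Normalization by \<open>exp_sum (f z) + \<bar>\<mu>\<bar>\<close>, which is positive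
  even for \<open>\<mu> = 0\<close>.\<close>

lemma Gamma_set_of_stationary:
  assumes "z \<in> \<Omega>" and v: "\<forall>i. v i \<in> limiting_subdifferential (\<lambda>x. f x $ i) z"
    and w: "w \<in> limiting_normal_cone z \<Omega>"
    and eq: "(\<Sum>i\<in>UNIV. exp (f z $ i) *\<^sub>R v i) + \<mu> *\<^sub>R z + w = 0"
  shows "z \<in> Gamma_set f \<Omega>"
proof -
  define s where "s = 1 / (exp_sum (f z) + \<bar>\<mu>\<bar>)"
  have pos: "exp_sum (f z) + \<bar>\<mu>\<bar> > 0" using exp_sum_pos[of "f z"] by simp
  then have s: "s > 0" by (simp add: s_def)
  let ?lam = "\<chi> i. s * exp (f z $ i)"
  have "(\<Sum>i\<in>UNIV. ?lam $ i *\<^sub>R v i) + (s * \<mu>) *\<^sub>R z + s *\<^sub>R w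
      = s *\<^sub>R ((\<Sum>i\<in>UNIV. exp (f z $ i) *\<^sub>R v i) + \<mu> *\<^sub>R z + w)"
    by (simp add: scaleR_sum_right scaleR_add_right)
  then have "0 = (\<Sum>i\<in>UNIV. ?lam $ i *\<^sub>R v i) + (s * \<mu>) *\<^sub>R z + s *\<^sub>R w"
    using eq by simp
  moreover have "(\<Sum>i\<in>UNIV. ?lam $ i) = s * exp_sum (f z)" by (simp add: exp_sum_def sum_distrib_left)
  then have "(\<Sum>i\<in>UNIV. ?lam $ i) + \<bar>s * \<mu>\<bar> = s * (exp_sum (f z) + \<bar>\<mu>\<bar>)"
    using s by (simp add: abs_mult algebra_simps)
  then have "(\<Sum>i\<in>UNIV. ?lam $ i) + \<bar>s * \<mu>\<bar> = 1" using pos by (simp add: s_def)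
  moreover have "?lam \<in> nonneg_orthant" using s by (simp add: nonneg_orthant_def)
  moreover have "\<forall>i. v i \<in> component_subgradients f z i" using v by (simp add: component_subgradients_def)
  moreover have "s *\<^sub>R w \<in> limiting_normal_cone z \<Omega>" using w s by (rule limiting_normal_cone_scaleR)
  ultimately show ?thesis using \<open>z \<in> \<Omega>\<close> unfolding Gamma_set_def by blast
qed

section \<open>Attained minima and convergent values\<close>

text \<open>Weierstrass on the sublevel set of \<open>x0\<close>, which is compact; outside it
  \<open>F\<close> exceeds \<open>F x0\<close>.\<close>

lemma attains_min_of_bounded_sublevel:
  fixes F :: "'a::euclidean_space \<Rightarrow> real"
  assumes "closed S" "x0 \<in> S" and F: "continuous_on UNIV F" and bdd: "bounded {x\<in>S. F x \<le> F x0}"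
  obtains z where "z \<in> S" "\<And>x. x \<in> S \<Longrightarrow> F z \<le> F x"
proof -
  have "{x\<in>S. F x \<le> F x0} = S \<inter> {x. F x \<le> F x0}" by blast
  moreover have "closed {x. F x \<le> F x0}"
    using F by (intro closed_Collect_le continuous_intros)
  ultimately have "compact {x\<in>S. F x \<le> F x0}"
    using assms by (simp add: compact_eq_bounded_closed closed_Int)
  moreover have "x0 \<in> {x\<in>S. F x \<le> F x0}" using assms by simp
  moreover have "continuous_on {x\<in>S. F x \<le> F x0} F" using F continuous_on_subset by blast
  ultimately obtain z where z: "z \<in> S" "F z \<le> F x0" "\<forall>x\<in>{x\<in>S. F x \<le> F x0}. F z \<le> F x"
    using continuous_attains_inf[of "{x\<in>S. F x \<le> F x0}" F] by blast
  show ?thesis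
  proof (rule that[OF z(1)])
    fix x assume "x \<in> S"
    then show "F z \<le> F x" using z(2,3) by (cases "F x \<le> F x0") auto
  qed
qed

lemma convergent_values_subsequence:
  fixes f :: "'a \<Rightarrow> real^'m" and x :: "nat \<Rightarrow> 'a"
  assumes "recession_cone (f ` \<Omega>) \<inter> uminus ` nonneg_orthant \<subseteq> {0}"
    and "\<And>n. x n \<in> \<Omega>" "\<And>n. exp_sum (f (x n)) \<le> c"
  obtains y s where "strict_mono s" "(\<lambda>n. f (x (s n))) \<longlonglongrightarrow> y"
proof -
  obtain B where "\<And>y. y \<in> f ` \<Omega> \<Longrightarrow> exp_sum y \<le> c \<Longrightarrow> norm y \<le> B"
    using exp_sum_sublevel_norm_bounded[OF assms(1)] by metis
  then have "bounded (range (\<lambda>n. f (x n)))" using assms by (intro boundedI[where B = B]) auto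
  from bounded_imp_convergent_subsequence[OF this]
  obtain y s where "strict_mono s" "((\<lambda>n. f (x n)) \<circ> s) \<longlonglongrightarrow> y" by blast
  then show ?thesis using that by (simp add: o_def)
qed

section \<open>Failure of M-tameness on unbounded sublevel sets\<close>

text \<open>Uses \<open>t \<le> 1 + t\<^sup>2\<close> for the deviation \<open>t\<close>, from
  nonnegativity of \<open>(t - 1)\<^sup>2\<close>.\<close>

lemma norm_le_of_sq_deviation:
  fixes u :: "'a::real_normed_vector"
  assumes "((norm u)\<^sup>2 - a)\<^sup>2 \<le> c"
  shows "\<bar>(norm u)\<^sup>2 - a\<bar> \<le> 1 + c"
proof -
  have "\<bar>(norm u)\<^sup>2 - a\<bar> \<le> 1 + ((norm u)\<^sup>2 - a)\<^sup>2"
    using zero_le_power2[of "\<bar>(norm u)\<^sup>2 - a\<bar> - 1"] zero_le_power2[of "(norm u)\<^sup>2 - a"]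
    by (simp add: power2_diff)
  then show ?thesis using assms by linarith
qed

text \<open>The penalty depends on the norm only, so its gradient is a multiple of \<open>u\<close>
  and stationarity takes the form required in \<open>Gamma_set\<close>. It also holds the minimizer
  near the sphere through the far point \<open>x\<close>.\<close>

lemma exists_Gamma_point:
  fixes f :: "'a::euclidean_space \<Rightarrow> real^'m"
  assumes f: "locally_lipschitz f" and \<Omega>: "closed \<Omega>"
    and unb: "\<not> bounded {x\<in>\<Omega>. exp_sum (f x) \<le> c}" and N: "N \<ge> 0"
  obtains z where "z \<in> Gamma_set f \<Omega>" "norm z \<ge> N" "exp_sum (f z) \<le> c"
proof -
  \<comment> \<open>The surplus \<open>1 + c\<close> absorbs the possible deviation of
    \<open>(norm z)\<^sup>2\<close> from \<open>(norm x)\<^sup>2\<close>.\<close>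
  obtain x where x: "x \<in> \<Omega>" "exp_sum (f x) \<le> c" "norm x \<ge> N + (1 + c)"
    using not_bounded_obtain_large[OF unb, of "N + (1 + c)"] by auto
  have c: "c > 0" using exp_sum_pos[of "f x"] x(2) by linarith
  define a where "a = (norm x)\<^sup>2"
  define g where "g u = ((norm u)\<^sup>2 - a)\<^sup>2" for u :: 'a
  define G where "G u = (4 * ((norm u)\<^sup>2 - a)) *\<^sub>R u" for u :: 'a
  have g: "(g has_derivative (\<lambda>d. G u \<bullet> d)) (at u)" for u
    unfolding g_def G_def power2_norm_eq_inner
    by (auto intro!: derivative_eq_intros simp: inner_commute algebra_simps power2_eq_square)
  have Gc: "isCont G u" for u unfolding G_def by (intro continuous_intros)
  define F where "F u = exp_sum (f u) + g u" for u
  have Fx: "F x \<le> c" using x by (simp add: F_def g_def a_def)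
  have sub: "\<bar>(norm u)\<^sup>2 - a\<bar> \<le> 1 + c" if "F u \<le> c" for u
    using that exp_sum_pos[of "f u"] by (intro norm_le_of_sq_deviation) (simp add: F_def g_def)
  have "continuous_on UNIV F" unfolding F_def g_def
    by (intro continuous_intros continuous_on_exp_sum f)
  moreover have "bounded {u\<in>\<Omega>. F u \<le> F x}"
  proof (rule boundedI[where B = "sqrt (a + 1 + c)"])
    fix u assume "u \<in> {u\<in>\<Omega>. F u \<le> F x}"
    then have "\<bar>(norm u)\<^sup>2 - a\<bar> \<le> 1 + c" using sub Fx by auto
    then show "norm u \<le> sqrt (a + 1 + c)" by (intro real_le_rsqrt) linarith
  qed
  ultimately obtain z where z: "z \<in> \<Omega>" and zmin: "\<And>u. u \<in> \<Omega> \<Longrightarrow> F z \<le> F u"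
    using attains_min_of_bounded_sublevel[OF \<Omega> x(1)] by blast
  have Fz: "F z \<le> c" using zmin[OF x(1)] Fx by linarith
  have zmin': "(\<Sum>i\<in>UNIV. exp (f z $ i)) + g z \<le> (\<Sum>i\<in>UNIV. exp (f u $ i)) + g u"
    if "u \<in> \<Omega>" "dist u z < 1" for u
    using zmin[OF that(1)] by (simp add: F_def exp_sum_def)
  obtain v w where vw: "\<forall>i. v i \<in> limiting_subdifferential (\<lambda>x. f x $ i) z"
    "w \<in> limiting_normal_cone z \<Omega>"
    "(\<Sum>i\<in>UNIV. exp (f z $ i) *\<^sub>R v i) + G z + w = 0"
    using exp_sum_local_min_stationary[OF f \<Omega> z g Gc zero_less_one zmin'] by blast
  have "z \<in> Gamma_set f \<Omega>"
    by (rule Gamma_set_of_stationary[OF z vw(1,2)]) (use vw(3) in \<open>simp add: G_def\<close>)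
  moreover have "norm z \<ge> N"
  proof -
    have "N\<^sup>2 + (1 + c) \<le> (N + (1 + c))\<^sup>2"
    proof -
      have "0 \<le> N * (1 + c)" "0 \<le> c * (1 + c)" using N c by auto
      then show ?thesis by (simp add: power2_eq_square algebra_simps)
    qed
    also have "\<dots> \<le> a" unfolding a_def using x(3) N c by (intro power_mono) auto
    finally have "N\<^sup>2 \<le> (norm z)\<^sup>2" using sub[OF Fz] by linarith
    then show ?thesis using power2_le_imp_le norm_ge_zero by blast
  qed
  moreover have "exp_sum (f z) \<le> c"
  proof -
    have "g z \<ge> 0" by (simp add: g_def)
    then show ?thesis using Fz unfolding F_def by linarith
  qed
  ultimately show ?thesis by (rule that)
qed

lemma T_inf_nonempty:
  fixes f :: "'a::euclidean_space \<Rightarrow> real^'m"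
  assumes rec: "recession_cone (f ` \<Omega>) \<inter> uminus ` nonneg_orthant \<subseteq> {0}"
    and f: "locally_lipschitz f" and \<Omega>: "closed \<Omega>"
    and unb: "\<not> bounded {x\<in>\<Omega>. exp_sum (f x) \<le> c}"
  shows "T_inf f \<Omega> \<noteq> {}"
proof -
  have "\<exists>z. z \<in> Gamma_set f \<Omega> \<and> norm z \<ge> real n \<and> exp_sum (f z) \<le> c" for n
    using exists_Gamma_point[OF f \<Omega> unb, of "real n"] by auto
  then obtain z where z: "\<And>n. z n \<in> Gamma_set f \<Omega>" "\<And>n. norm (z n) \<ge> real n"
    "\<And>n. exp_sum (f (z n)) \<le> c" by metis
  have z\<Omega>: "z n \<in> \<Omega>" for n using z(1)[of n] by (simp add: Gamma_set_def)
  obtain y s where s: "strict_mono s" "(\<lambda>n. f (z (s n))) \<longlonglongrightarrow> y"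
    by (rule convergent_values_subsequence[OF rec z\<Omega> z(3)])
  have "filterlim (\<lambda>n. norm (z (s n))) at_top sequentially"
    using norm_at_top_of_ge_nat[OF z(2)] filterlim_subseq[OF s(1)] by (rule filterlim_compose)
  then have "y \<in> T_inf f \<Omega>" unfolding T_inf_def using z(1) s(2)
    by (intro CollectI exI[of _ "\<lambda>n. z (s n)"]) simp
  then show ?thesis by blast
qed

section \<open>Failure of the weak Palais-Smale condition on unbounded sublevel sets\<close>

text \<open>A variational principle in the spirit of Ekeland with a quadratic perturbation:
  \<open>x\<close> is minimal up to \<open>2 * \<epsilon>\<close> among points of norm at least
  \<open>R\<close>, so the perturbed minimizer stays within \<open>norm x / 2\<close> of
  \<open>x\<close> and the perturbation gradient there is of order
  \<open>\<epsilon> / norm x\<close>.\<close>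

lemma exists_slow_point:
  fixes f :: "'a::euclidean_space \<Rightarrow> real^'m"
  assumes f: "locally_lipschitz f" and \<Omega>: "closed \<Omega>" and \<epsilon>: "\<epsilon> > 0"
    and low: "\<And>u. u \<in> \<Omega> \<Longrightarrow> R \<le> norm u \<Longrightarrow> \<alpha> - \<epsilon> < exp_sum (f u)"
    and x: "x \<in> \<Omega>" "exp_sum (f x) < \<alpha> + \<epsilon>" "norm x > 0" "2 * R < norm x"
  shows "\<exists>z\<in>\<Omega>. norm x / 2 \<le> norm z \<and> exp_sum (f z) \<le> \<alpha> + \<epsilon> \<and>
    ereal (norm z) * rabier f \<Omega> z \<le> ereal (12 * \<epsilon> / exp_sum (f z))"
proof -
  \<comment> \<open>With this factor, a penalty of at most \<open>2 * \<epsilon>\<close> means a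
    distance of at most \<open>norm x / 2\<close>.\<close>
  define c where "c = 8 * \<epsilon> / (norm x)\<^sup>2"
  have c: "c > 0" using \<epsilon> x by (simp add: c_def)
  define g where "g u = c * (norm (u - x))\<^sup>2" for u
  define G where "G u = (2 * c) *\<^sub>R (u - x)" for u
  have g: "(g has_derivative (\<lambda>d. G u \<bullet> d)) (at u)" for u
    unfolding g_def G_def by (rule norm_sq_has_derivative)
  have Gc: "isCont G u" for u unfolding G_def by (intro continuous_intros)
  define F where "F u = exp_sum (f u) + g u" for u
  define S where "S = \<Omega> \<inter> {u. R \<le> norm u}"
  have "closed S" unfolding S_def
    by (intro closed_Int \<Omega> closed_Collect_le continuous_intros)
  moreover have "R \<le> norm x" using x(3,4) by linarith
  then have xS: "x \<in> S" using x(1) by (simp add: S_def)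
  moreover have "continuous_on UNIV F" unfolding F_def g_def
    by (intro continuous_intros continuous_on_exp_sum f)
  moreover have "bounded {u\<in>S. F u \<le> F x}"
  proof (rule boundedI[where B = "norm x + sqrt (exp_sum (f x) / c)"])
    fix u assume "u \<in> {u\<in>S. F u \<le> F x}"
    then have "c * (norm (u - x))\<^sup>2 \<le> exp_sum (f x)"
      using exp_sum_pos[of "f u"] by (simp add: F_def g_def)
    then have "(norm (u - x))\<^sup>2 \<le> exp_sum (f x) / c" using c by (simp add: field_simps)
    then have "norm (u - x) \<le> sqrt (exp_sum (f x) / c)" by (rule real_le_rsqrt)
    then show "norm u \<le> norm x + sqrt (exp_sum (f x) / c)"
      using norm_triangle_sub[of u x] by linarith
  qed
  ultimately obtain z where z: "z \<in> S" and zmin: "\<And>u. u \<in> S \<Longrightarrow> F z \<le> F u"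
    using attains_min_of_bounded_sublevel by blast
  have z\<Omega>: "z \<in> \<Omega>" and zR: "R \<le> norm z" using z by (auto simp: S_def)
  have Fz: "exp_sum (f z) + c * (norm (z - x))\<^sup>2 \<le> exp_sum (f x)"
    using zmin[OF xS] by (simp add: F_def g_def)
  have zx: "norm (z - x) \<le> norm x / 2"
  proof -
    have "c * (norm (z - x))\<^sup>2 \<le> 2 * \<epsilon>" using Fz low[OF z\<Omega> zR] x(2) by linarith
    then have "(norm (z - x))\<^sup>2 \<le> (norm x / 2)\<^sup>2"
      using \<epsilon> x(3) by (simp add: c_def field_simps)
    then show ?thesis using power2_le_imp_le[of "norm (z - x)" "norm x / 2"] by simp
  qed
  have z1: "norm x / 2 \<le> norm z" using norm_triangle_sub[of x z] zx by (simp add: norm_minus_commute)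
  have z2: "norm z \<le> 3 / 2 * norm x" using norm_triangle_sub[of z x] zx by linarith
  \<comment> \<open>The constraint \<open>R \<le> norm u\<close> is inactive at \<open>z\<close>, so
    \<open>z\<close> is a local minimizer on \<open>\<Omega>\<close> itself.\<close>
  have \<rho>: "norm z - R > 0" using z1 x(4) by linarith
  have zmin': "(\<Sum>i\<in>UNIV. exp (f z $ i)) + g z \<le> (\<Sum>i\<in>UNIV. exp (f u $ i)) + g u"
    if "u \<in> \<Omega>" "dist u z < norm z - R" for u
  proof -
    have "R \<le> norm u" using that(2) norm_triangle_sub[of z u] by (simp add: dist_norm norm_minus_commute)
    then show ?thesis using zmin[of u] that(1) by (simp add: S_def F_def exp_sum_def)
  qed
  obtain v w where vw: "\<forall>i. v i \<in> limiting_subdifferential (\<lambda>x. f x $ i) z"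
    "w \<in> limiting_normal_cone z \<Omega>"
    "(\<Sum>i\<in>UNIV. exp (f z $ i) *\<^sub>R v i) + G z + w = 0"
    using exp_sum_local_min_stationary[OF f \<Omega> z\<Omega> g Gc \<rho> zmin'] by blast
  \<comment> \<open>The right-hand side is \<open>12 * \<epsilon>\<close>: the size of
    \<open>z\<close> and the smallness of the gradient compensate exactly.\<close>
  have "norm z * norm (G z) \<le> (3 / 2 * norm x) * (8 * \<epsilon> / norm x)"
  proof (rule mult_mono[OF z2])
    have "norm (G z) = 2 * c * norm (z - x)" using c by (simp add: G_def)
    also have "\<dots> \<le> 2 * c * (norm x / 2)" using c zx by (intro mult_left_mono) auto
    also have "\<dots> = 8 * \<epsilon> / norm x" using x(3) by (simp add: c_def power2_eq_square)
    finally show "norm (G z) \<le> 8 * \<epsilon> / norm x" .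
  qed auto
  then have "norm z * norm (G z) \<le> 12 * \<epsilon>" using x(3) by simp
  then have le: "norm z * (norm (G z) / exp_sum (f z)) \<le> 12 * \<epsilon> / exp_sum (f z)"
    using exp_sum_pos[of "f z"] by (simp add: divide_right_mono)
  have "ereal (norm z) * rabier f \<Omega> z \<le> ereal (norm z) * ereal (norm (G z) / exp_sum (f z))"
    by (intro ereal_mult_left_mono rabier_le_of_stationary[OF vw]) simp
  also have "\<dots> \<le> ereal (12 * \<epsilon> / exp_sum (f z))" using le by simp
  finally have "ereal (norm z) * rabier f \<Omega> z \<le> ereal (12 * \<epsilon> / exp_sum (f z))" .
  moreover have "exp_sum (f z) \<le> \<alpha> + \<epsilon>"
  proof -
    have "c * (norm (z - x))\<^sup>2 \<ge> 0" using c by simp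
    then show ?thesis using Fz x(2) by linarith
  qed
  ultimately show ?thesis using z1 z\<Omega> by blast
qed

text \<open>Slow points are taken for \<open>\<epsilon> = 1 / real (Suc n)\<close> around the lower
  limit of \<open>exp_sum (f x)\<close> at infinity. Along a subsequence their values converge, and
  the bound \<open>12 * \<epsilon> / exp_sum (f z)\<close> tends to 0 because the denominators have
  a positive limit.\<close>

lemma K_inf_nonempty:
  fixes f :: "'a::euclidean_space \<Rightarrow> real^'m"
  assumes rec: "recession_cone (f ` \<Omega>) \<inter> uminus ` nonneg_orthant \<subseteq> {0}"
    and f: "locally_lipschitz f" and \<Omega>: "closed \<Omega>"
    and unb: "\<not> bounded {x\<in>\<Omega>. exp_sum (f x) \<le> c}"
  shows "K_inf f \<Omega> \<noteq> {}"
proof -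
  define A where "A = {a. \<forall>R. \<exists>x\<in>\<Omega>. R \<le> norm x \<and> exp_sum (f x) \<le> a}"
  have "c \<in> A" unfolding A_def using not_bounded_obtain_large[OF unb] by blast
  have Apos: "a \<ge> 0" if a: "a \<in> A" for a
  proof -
    obtain x where "exp_sum (f x) \<le> a" using a unfolding A_def by blast
    then show ?thesis using exp_sum_pos[of "f x"] by linarith
  qed
  then have bdd: "bdd_below A" by (rule bdd_belowI)
  \<comment> \<open>the lower limit of \<open>exp_sum (f x)\<close> as \<open>norm x\<close> tends to infinity in \<open>\<Omega>\<close>\<close>
  define \<alpha> where "\<alpha> = Inf A"
  have "\<exists>z. z \<in> \<Omega> \<and> real n \<le> norm z \<and> exp_sum (f z) \<le> \<alpha> + 1 \<and>
    ereal (norm z) * rabier f \<Omega> z \<le> ereal (12 * (1 / real (Suc n)) / exp_sum (f z))" for n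
  proof -
    define \<epsilon> where "\<epsilon> = 1 / real (Suc n)"
    have \<epsilon>: "\<epsilon> > 0" "\<epsilon> \<le> 1" by (auto simp: \<epsilon>_def)
    \<comment> \<open>A level below the lower limit is exceeded everywhere beyond some radius
      \<open>R\<close>.\<close>
    have "\<alpha> - \<epsilon> \<notin> A" using cInf_lower[OF _ bdd, of "\<alpha> - \<epsilon>"] \<epsilon> by (auto simp: \<alpha>_def)
    then have "\<exists>R. \<forall>u\<in>\<Omega>. R \<le> norm u \<longrightarrow> \<alpha> - \<epsilon> < exp_sum (f u)"
      by (auto simp: A_def not_le imp_conv_disj)
    then obtain R where R: "\<And>u. u \<in> \<Omega> \<Longrightarrow> R \<le> norm u \<Longrightarrow> \<alpha> - \<epsilon> < exp_sum (f u)"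
      by blast
    obtain a where "a \<in> A" "a < \<alpha> + \<epsilon>"
      using cInf_lessD[of A "\<alpha> + \<epsilon>"] \<open>c \<in> A\<close> \<epsilon> unfolding \<alpha>_def by auto
    \<comment> \<open>Far enough for \<open>2 * R < norm x\<close>, for \<open>norm x > 0\<close>,
      and for \<open>norm x / 2\<close> to be at least \<open>n\<close>.\<close>
    then obtain x where x: "x \<in> \<Omega>" "2 * \<bar>R\<bar> + 2 * real n + 1 \<le> norm x" "exp_sum (f x) \<le> a"
      unfolding A_def by blast
    have "exp_sum (f x) < \<alpha> + \<epsilon>" "norm x > 0" "2 * R < norm x"
      using x(2,3) \<open>a < \<alpha> + \<epsilon>\<close> by linarith+
    from exists_slow_point[OF f \<Omega> \<epsilon>(1) R x(1) this]
    obtain z where z: "z \<in> \<Omega>" "norm x / 2 \<le> norm z" "exp_sum (f z) \<le> \<alpha> + \<epsilon>"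
        "ereal (norm z) * rabier f \<Omega> z \<le> ereal (12 * \<epsilon> / exp_sum (f z))" by blast
    have "real n \<le> norm z" using z(2) x(2) by linarith
    moreover have "exp_sum (f z) \<le> \<alpha> + 1" using z(3) \<epsilon> by linarith
    ultimately show ?thesis using z unfolding \<epsilon>_def by blast
  qed
  then obtain z where z: "\<And>n. z n \<in> \<Omega>" "\<And>n. real n \<le> norm (z n)" "\<And>n. exp_sum (f (z n)) \<le> \<alpha> + 1"
    "\<And>n. ereal (norm (z n)) * rabier f \<Omega> (z n) \<le> ereal (12 * (1 / real (Suc n)) / exp_sum (f (z n)))"
    by metis
  obtain y s where s: "strict_mono s" "(\<lambda>n. f (z (s n))) \<longlonglongrightarrow> y"
    by (rule convergent_values_subsequence[OF rec z(1,3)])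
  have "(\<lambda>n. 1 / real (Suc n)) \<longlonglongrightarrow> 0" using LIMSEQ_Suc lim_const_over_n by blast
  from LIMSEQ_subseq_LIMSEQ[OF this s(1)] have "(\<lambda>n. 1 / real (Suc (s n))) \<longlonglongrightarrow> 0" by (simp add: o_def)
  moreover have "exp_sum y \<noteq> 0" using exp_sum_pos[of y] by simp
  ultimately have "(\<lambda>n. 12 * (1 / real (Suc (s n))) / exp_sum (f (z (s n)))) \<longlonglongrightarrow> 12 * 0 / exp_sum y"
    by (intro tendsto_intros tendsto_exp_sum s(2))
  then have up: "(\<lambda>n. ereal (12 * (1 / real (Suc (s n))) / exp_sum (f (z (s n))))) \<longlonglongrightarrow> 0"
    by (simp add: zero_ereal_def)
  have "(\<lambda>n. ereal (norm (z (s n))) * rabier f \<Omega> (z (s n))) \<longlonglongrightarrow> 0"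
  proof (rule tendsto_sandwich[OF _ _ tendsto_const up])
    show "\<forall>\<^sub>F n in sequentially. 0 \<le> ereal (norm (z (s n))) * rabier f \<Omega> (z (s n))"
      by (intro always_eventually allI ereal_0_le_mult rabier_nonneg) simp
    show "\<forall>\<^sub>F n in sequentially. ereal (norm (z (s n))) * rabier f \<Omega> (z (s n))
        \<le> ereal (12 * (1 / real (Suc (s n))) / exp_sum (f (z (s n))))"
      by (intro always_eventually allI z(4))
  qed
  moreover have "filterlim (\<lambda>n. norm (z (s n))) at_top sequentially"
    using norm_at_top_of_ge_nat[OF z(2)] filterlim_subseq[OF s(1)] by (rule filterlim_compose)
  ultimately have "y \<in> K_inf f \<Omega>" unfolding K_inf_def using z(1) s(2)
    by (intro CollectI exI[of _ "\<lambda>n. z (s n)"]) simp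
  then show ?thesis by blast
qed

section \<open>Existence of properly efficient solutions\<close>

text \<open>\<open>exp_sum\<close> is strictly increasing for the componentwise order, so a
  dominating point would lie below the minimum.\<close>

lemma pareto_efficient_of_exp_sum_min:
  assumes "z \<in> \<Omega>" and min: "\<And>x. x \<in> \<Omega> \<Longrightarrow> exp_sum (f z) \<le> exp_sum (f x)"
  shows "pareto_efficient f \<Omega> z"
proof -
  have False if x: "x \<in> \<Omega>" "f x \<le> f z" "f x \<noteq> f z" for x
  proof -
    obtain i where "f x $ i \<noteq> f z $ i" using x(3) by (auto simp: vec_eq_iff)
    then have "f x $ i < f z $ i" using x(2) by (simp add: less_eq_vec_def order_less_le)
    then have "exp_sum (f x) < exp_sum (f z)"
      unfolding exp_sum_def using x(2) by (intro sum_strict_mono_ex1) (auto simp: less_eq_vec_def)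
    then show False using min[OF x(1)] by simp
  qed
  then show ?thesis using assms(1) unfolding pareto_efficient_def by blast
qed

text \<open>An improvement \<open>a\<close> of one objective that is large against every deterioration bounds \<open>norm (f x)\<close>,
  hence \<open>a\<close>, by the recession condition; on bounded values \<open>exp\<close> is bi-Lipschitz, so minimality of
  the sum of exponentials limits the trade-off.\<close>

lemma geoffrion_of_exp_sum_min:
  fixes f :: "'a \<Rightarrow> real^'m"
  assumes rec: "recession_cone (f ` \<Omega>) \<inter> uminus ` nonneg_orthant \<subseteq> {0}"
    and z: "z \<in> \<Omega>" and min: "\<And>x. x \<in> \<Omega> \<Longrightarrow> exp_sum (f z) \<le> exp_sum (f x)"
  shows "geoffrion_properly_efficient f \<Omega> z"
proof -
  obtain C where C: "C > 0" "\<forall>y\<in>f ` \<Omega>. \<exists>j. norm y \<le> C * (1 + max 0 (y $ j))"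
    using norm_le_some_component[OF rec] by blast
  define b where "b = norm (f z)"
  define m where "m = real CARD('m)"
  \<comment> \<open>Bounds the improvement \<open>a\<close> below, which will satisfy
    \<open>a \<le> b + C * (1 + b) + a / 2\<close>.\<close>
  define A where "A = 2 * (b + C * (1 + b))"
  \<comment> \<open>\<open>2 * C\<close> yields \<open>C * (a / M) \<le> a / 2\<close>, the summand
    1 yields \<open>a / M \<le> a\<close>, and the last summand contradicts the final inequality
    \<open>M \<le> m * exp (2 * (b + A))\<close>.\<close>
  define M where "M = 2 * C + 1 + m * exp (2 * (b + A))"
  have b: "b \<ge> 0" by (simp add: b_def)
  have m: "m > 0" by (simp add: m_def)
  have M: "M \<ge> 2 * C" "M \<ge> 1" "M > m * exp (2 * (b + A))"
    using C m by (auto simp: M_def add_pos_nonneg)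
  have "\<exists>j. f z $ j < f x $ j \<and> (f z $ i - f x $ i) / (f x $ j - f z $ j) \<le> M"
    if x: "x \<in> \<Omega>" and imp: "f x $ i < f z $ i" for i x
  proof (rule ccontr)
    assume neg: "\<not> ?thesis"
    define a where "a = f z $ i - f x $ i"
    have a: "a > 0" using imp by (simp add: a_def)
    have aM: "0 \<le> a / M" "a / M \<le> a" using a M by (auto simp: field_simps)
    \<comment> \<open>Since no \<open>j\<close> satisfies the trade-off bound, every deterioration
      is at most \<open>a / M\<close>.\<close>
    have up: "f x $ j - f z $ j \<le> a / M" for j
    proof (cases "f z $ j < f x $ j")
      case True
      then have "M < a / (f x $ j - f z $ j)" using neg by (auto simp: a_def not_le)
      then show ?thesis using True M by (simp add: field_simps)
    qed (use aM in linarith)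
    have fz: "\<bar>f z $ j\<bar> \<le> b" for j unfolding b_def by (rule component_le_norm_cart)
    obtain j where j: "norm (f x) \<le> C * (1 + max 0 (f x $ j))" using C x by blast
    also have "\<dots> \<le> C * (1 + (b + a / M))"
      using C up[of j] fz[of j] aM by (intro mult_left_mono) auto
    finally have "norm (f x) \<le> C * (1 + b) + C * (a / M)" by (simp add: algebra_simps)
    moreover have "C * (a / M) \<le> a / 2"
    proof -
      have "a * (2 * C) \<le> a * M" using a M by (intro mult_left_mono) auto
      then show ?thesis using M by (simp add: field_simps)
    qed
    moreover have "a \<le> b + norm (f x)"
      using fz[of i] component_le_norm_cart[of "f x" i] unfolding a_def by linarith
    moreover have "A = 2 * b + 2 * (C * (1 + b))" by (simp add: A_def)
    ultimately have aA: "a \<le> A" by linarith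
    have fx: "f x $ j \<le> b + A" for j using up[of j] fz[of j] aM aA by linarith
    \<comment> \<open>The increase of each summand is small by the factor
      \<open>1 / M\<close>.\<close>
    have "exp (f x $ j) - exp (f z $ j) \<le> exp (b + A) * (a / M)" for j
    proof -
      have "exp (f x $ j) - exp (f z $ j) \<le> exp (f x $ j) * (f x $ j - f z $ j)"
        by (rule exp_diff_le)
      also have "\<dots> \<le> exp (f x $ j) * (a / M)" using up by (intro mult_left_mono) auto
      also have "\<dots> \<le> exp (b + A) * (a / M)" using fx[of j] aM by (intro mult_right_mono) auto
      finally show ?thesis .
    qed
    then have "(\<Sum>j\<in>UNIV - {i}. exp (f x $ j) - exp (f z $ j)) \<le> (\<Sum>j\<in>UNIV - {i}. exp (b + A) * (a / M))"
      by (intro sum_mono)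
    also have "\<dots> \<le> (\<Sum>j\<in>(UNIV::'m set). exp (b + A) * (a / M))"
      using aM(1) by (intro sum_mono2 mult_nonneg_nonneg) auto
    also have "\<dots> = m * (exp (b + A) * (a / M))" by (simp add: m_def)
    finally have others: "(\<Sum>j\<in>UNIV - {i}. exp (f x $ j) - exp (f z $ j)) \<le> m * (exp (b + A) * (a / M))" .
    \<comment> \<open>The decrease of summand \<open>i\<close> is at least \<open>a\<close> times a
      factor independent of \<open>x\<close>, because \<open>f x $ i\<close> is bounded below by
      \<open>- (b + A)\<close>.\<close>
    have "exp (f x $ i) - exp (f z $ i) \<le> - (exp (- (b + A)) * a)"
    proof -
      have "exp (f x $ i) * (1 + a) \<le> exp (f x $ i) * exp a"
        by (intro mult_left_mono exp_ge_add_one_self) auto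
      also have "\<dots> = exp (f z $ i)" by (simp add: a_def flip: exp_add)
      finally have "exp (f x $ i) - exp (f z $ i) \<le> - (exp (f x $ i) * a)" by (simp add: algebra_simps)
      moreover have "- (b + A) \<le> f x $ i" using fz[of i] aA unfolding a_def by linarith
      then have "exp (- (b + A)) * a \<le> exp (f x $ i) * a" using a by (intro mult_right_mono) auto
      ultimately show ?thesis by linarith
    qed
    moreover have "0 \<le> (\<Sum>j\<in>UNIV. exp (f x $ j) - exp (f z $ j))"
      using min[OF x] by (simp add: exp_sum_def sum_subtractf)
    ultimately have "exp (- (b + A)) * a \<le> m * (exp (b + A) * (a / M))"
      using others sum.remove[of UNIV i "\<lambda>j. exp (f x $ j) - exp (f z $ j)"] by simp
    then have "exp (b + A) * (exp (- (b + A)) * a) \<le> exp (b + A) * (m * (exp (b + A) * (a / M)))"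
      by (intro mult_left_mono) auto
    moreover have "exp (b + A) * (exp (- (b + A)) * a) = a"
      by (simp add: mult.assoc[symmetric] flip: exp_add)
    moreover have "exp (b + A) * exp (b + A) = exp (2 * (b + A))" by (simp flip: exp_add)
    then have "exp (b + A) * (m * (exp (b + A) * (a / M))) = (m * exp (2 * (b + A))) * a / M"
      by (simp add: mult_ac)
    ultimately have "a \<le> (m * exp (2 * (b + A))) * a / M" by linarith
    then have "M \<le> m * exp (2 * (b + A))" using a M(2) by (simp add: field_simps)
    then show False using M(3) by linarith
  qed
  moreover have "M > 0" using M by linarith
  ultimately show ?thesis
    unfolding geoffrion_properly_efficient_def
    using pareto_efficient_of_exp_sum_min[of z \<Omega> f, OF z min] by blast
qed

section \<open>Equivalence of the four conditions and existence of a solution\<close>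

theorem theorem4p2:
  fixes f :: "real^'n \<Rightarrow> real^'m" and \<Omega> :: "(real^'n) set"
  assumes "locally_lipschitz f"
    and "\<Omega> \<noteq> {}" and "closed \<Omega>"
    and "recession_cone (f ` \<Omega>) \<inter> uminus ` nonneg_orthant = {0}"
  shows "(proper_on f \<Omega> \<longleftrightarrow> palais_smale f \<Omega>) \<and>
         (proper_on f \<Omega> \<longleftrightarrow> weak_palais_smale f \<Omega>) \<and>
         (proper_on f \<Omega> \<longleftrightarrow> M_tame f \<Omega>) \<and>
         (proper_on f \<Omega> \<or> palais_smale f \<Omega> \<or> weak_palais_smale f \<Omega> \<or> M_tame f \<Omega> \<longrightarrow>
            (\<exists>xb. geoffrion_properly_efficient f \<Omega> xb))"
proof -
  have rec: "recession_cone (f ` \<Omega>) \<inter> uminus ` nonneg_orthant \<subseteq> {0}" using assms(4) by simp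
  note proper_iff = proper_on_iff_exp_sum_sublevels_bounded[OF rec]
  \<comment> \<open>Properness, the Palais-Smale condition and its weak form are linked in a cycle;
    M-tameness is linked to properness in both directions.\<close>
  have proper: "palais_smale f \<Omega> \<and> M_tame f \<Omega>" if "proper_on f \<Omega>"
    using that proper_imp_sets_at_infinity_empty[of \<Omega> f]
    unfolding proper_iff palais_smale_def M_tame_def by blast
  have ps: "palais_smale f \<Omega> \<Longrightarrow> weak_palais_smale f \<Omega>"
    unfolding palais_smale_def weak_palais_smale_def using K_inf_subset_K_tilde_inf[of f \<Omega>] by blast
  have wps: "weak_palais_smale f \<Omega> \<Longrightarrow> proper_on f \<Omega>"
    unfolding proper_iff weak_palais_smale_def using K_inf_nonempty[OF rec assms(1,3)] by blast
  have tame: "M_tame f \<Omega> \<Longrightarrow> proper_on f \<Omega>"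
    unfolding proper_iff M_tame_def using T_inf_nonempty[OF rec assms(1,3)] by blast
  have "\<exists>xb. geoffrion_properly_efficient f \<Omega> xb" if "proper_on f \<Omega>"
  proof -
    obtain x0 where "x0 \<in> \<Omega>" using assms(2) by blast
    \<comment> \<open>The sublevel set at the value of any point of \<open>\<Omega>\<close> is
      bounded, which gives a global minimizer of \<open>exp_sum (f x)\<close> on
      \<open>\<Omega>\<close>.\<close>
    moreover have "bounded {x\<in>\<Omega>. exp_sum (f x) \<le> exp_sum (f x0)}" using that proper_iff by blast
    ultimately obtain z where "z \<in> \<Omega>" "\<And>x. x \<in> \<Omega> \<Longrightarrow> exp_sum (f z) \<le> exp_sum (f x)"
      using attains_min_of_bounded_sublevel[OF assms(3) _ continuous_on_exp_sum[OF assms(1)]] by blast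
    then show ?thesis using geoffrion_of_exp_sum_min[OF rec] by blast
  qed
  then show ?thesis using proper ps wps tame by blast
qed

end
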